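(* Let $\alpha=(\alpha_1,\alpha_2)\in\mathbb{R}^2$. If $\alpha\preceq(0,0)$, then $\mathcal{M}(D_\alpha)=H^\infty(\mathbb{U}^2)$.
   Context: $\mathbb{U}$ is the open unit disc in $\mathbb{C}$, $\mathbb{U}^2=\mathbb{U}\times\mathbb{U}$, and $\mathbb{Z}_+$ is the set of nonnegative integers. For $\alpha=(\alpha_1,\alpha_2)\in\mathbb{R}^2$, $D_\alpha$ is the space of functions $f(z,w)=\sum_{(k,l)\in\mathbb{Z}_+^2}a_{k,l}z^kw^l$ on $\mathbb{U}^2$ with $\sum_{(k,l)}|a_{k,l}|^2(k+1)^{\alpha_1}(l+1)^{\alpha_2}<\infty$. $\mathcal{M}(D_\alpha)$ is the set of functions $\phi:\mathbb{U}^2\to\mathbb{C}$ such that $\phi f\in D_\alpha$ for all $f\in D_\alpha$. $H^\infty(\mathbb{U}^2)$ is the set of bounded holomorphic functions on $\mathbb{U}^2$. $\alpha\preceq\beta$ means $\alpha_1\le\beta_1$ and $\alpha_2\le\beta_2$. *)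

theory Defs
  imports "HOL-Analysis.Analysis" "HOL-Library.Product_Order"
begin

text \<open>
  Functions on the bidisc are total functions on \<^typ>\<open>complex \<times> complex\<close> whose values
  off the bidisc are irrelevant: every set of functions below is defined by conditions on the
  values on the bidisc only, so it contains with a function all functions that agree with it there.
  The order on \<^typ>\<open>real \<times> real\<close> is the componentwise one of
  \<^theory>\<open>HOL-Library.Product_Order\<close>.
\<close>

definition bidisc :: "(complex \<times> complex) set" where
  "bidisc = ball 0 1 \<times> ball 0 1"

definition Dspace :: "real \<times> real \<Rightarrow> (complex \<times> complex \<Rightarrow> complex) set" where
  "Dspace \<alpha> = {f. \<exists>a :: nat \<times> nat \<Rightarrow> complex.
     (\<forall>(z, w) \<in> bidisc. ((\<lambda>(k, l). a (k, l) * z ^ k * w ^ l) has_sum f (z, w)) UNIV) \<and>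
     (\<lambda>(k, l). (cmod (a (k, l)))\<^sup>2 * (real k + 1) powr fst \<alpha> * (real l + 1) powr snd \<alpha>)
       summable_on UNIV}"

definition multipliers :: "real \<times> real \<Rightarrow> (complex \<times> complex \<Rightarrow> complex) set" where
  "multipliers \<alpha> = {\<phi>. \<forall>f \<in> Dspace \<alpha>. (\<lambda>p. \<phi> p * f p) \<in> Dspace \<alpha>}"

text \<open>
  Holomorphy in two variables: the (Frechet) derivative exists at every point of the open set
  and is complex linear, i.e. of the form \<open>(h, k) \<mapsto> c * h + d * k\<close>.
\<close>

definition holomorphic2_on ::
    "(complex \<times> complex \<Rightarrow> complex) \<Rightarrow> (complex \<times> complex) set \<Rightarrow> bool"
    (infixl "holomorphic2'_on" 50) where
  "f holomorphic2_on S \<longleftrightarrow>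
     (\<forall>p \<in> S. \<exists>c d. (f has_derivative (\<lambda>(h, k). c * h + d * k)) (at p))"

definition Hinf_bidisc :: "(complex \<times> complex \<Rightarrow> complex) set" where
  "Hinf_bidisc = {f. f holomorphic2_on bidisc \<and> bounded (f ` bidisc)}"

end

theory Submission
  imports Defs "HOL-Complex_Analysis.Complex_Analysis" "HOL-Real_Asymp.Real_Asymp"
begin

text \<open>
  Identify a function in \<open>D\<^sub>\<alpha>\<close> with its coefficient family; then \<open>D\<^sub>\<alpha>\<close> is the weighted
  \<open>l\<^sup>2\<close> space over \<^typ>\<open>nat \<times> nat\<close> with weight \<open>(k + 1) powr fst \<alpha> * (l + 1) powr snd \<alpha>\<close>, and
  the value at \<open>(z, w)\<close> is the pairing with the family \<open>z\<^sup>k w\<^sup>l\<close>.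

  A multiplier is bounded. Evaluation at a point \<open>p\<close> is a functional of finite norm \<open>K(p)\<close> on
  this space, attained by the normalised reproducing kernel at \<open>p\<close>. If \<open>\<phi>\<close> were unbounded, pick
  points \<open>p\<^sub>m\<close> at which \<open>\<phi>\<close> grows faster than \<open>5\<^sup>m\<close>. A gliding hump argument
  (\<open>gliding_hump\<close>) superposes the normalised kernels into an \<open>f\<close> in the space with
  \<open>\<bar>f(p\<^sub>m)\<bar> \<ge> 5\<^sup>-\<^sup>m K(p\<^sub>m) / 4\<close> for all \<open>m\<close> at once. Then \<open>\<phi> f\<close> is too large at the points \<open>p\<^sub>m\<close> to lie in
  the space (\<open>multiplier_bounded\<close>). This takes the place of the closed graph theorem.
  Holomorphy is simpler: \<open>\<phi> = \<phi> \<cdot> 1\<close> has a convergent power series, which can be differentiated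
  term by term (\<open>power_series2_imp_holomorphic2\<close>).

  A bounded holomorphic \<open>\<phi>\<close> is a multiplier. It has a power series
  (\<open>bounded_holomorphic2_imp_power_series2\<close>), so \<open>\<phi> f\<close> has as coefficients the
  convolution \<open>b\<close> of the coefficients of \<open>\<phi>\<close> with the coefficients \<open>a\<close> of \<open>f\<close>. Within a rectangle
  \<open>k \<le> N, l \<le> M\<close> the convolution sees only the part of \<open>a\<close> in the same rectangle, so \<open>f\<close> may be
  replaced there by a polynomial \<open>h\<close>; Parseval's identity on tori and \<open>\<bar>\<phi> h\<bar> \<le> C \<bar>h\<bar>\<close> then give
  \<open>\<Sum> \<bar>b\<bar>\<^sup>2 \<le> C\<^sup>2 \<Sum> \<bar>a\<bar>\<^sup>2\<close> over every such rectangle (\<open>bounded_multiplier_coeffs_le\<close>). For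
  \<open>\<alpha> \<le> (0, 0)\<close> the weights are products of decreasing sequences, and by Abel summation in each
  index the inequalities over rectangles imply the weighted one (\<open>weighted_sum_mono2\<close>).
\<close>

section \<open>Pairings and superpositions in weighted square-summable spaces\<close>

text \<open>
  The arithmetic-geometric mean inequality replaces Cauchy-Schwarz: the bound is linear in \<open>K\<close> with
  a constant that depends on \<open>a\<close> only, which is all that is needed, and it equals \<open>K\<close> when \<open>A = 1\<close>.
\<close>

lemma weighted_pairing_bound:
  fixes a x :: "'i \<Rightarrow> complex" and W :: "'i \<Rightarrow> real"
  assumes W: "\<And>i. W i > 0"
    and A: "((\<lambda>i. (cmod (a i))\<^sup>2 * W i) has_sum A) UNIV"
    and K: "((\<lambda>i. (cmod (x i))\<^sup>2 / W i) has_sum K\<^sup>2) UNIV" "K > 0"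
  shows "(\<lambda>i. cmod (a i * x i)) summable_on UNIV"
    and "(\<Sum>\<^sub>\<infinity>i. cmod (a i * x i)) \<le> K * (A + 1) / 2"
    and "cmod (\<Sum>\<^sub>\<infinity>i. a i * x i) \<le> K * (A + 1) / 2"
proof -
  define g where "g i = K / 2 * ((cmod (a i))\<^sup>2 * W i) + 1 / (2 * K) * ((cmod (x i))\<^sup>2 / W i)" for i
  have gs: "(g has_sum (K / 2 * A + 1 / (2 * K) * K\<^sup>2)) UNIV"
    unfolding g_def by (intro has_sum_add has_sum_cmult_right A K)
  have le: "cmod (a i * x i) \<le> g i" for i
  proof -
    have "0 \<le> (K * W i * cmod (a i) - cmod (x i))\<^sup>2 / (2 * K * W i)"
      using W[of i] K(2) by simp
    also have "\<dots> = g i - cmod (a i * x i)"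
      using W[of i] K(2) by (simp add: g_def norm_mult power2_eq_square field_simps)
    finally show ?thesis by simp
  qed
  show abs: "(\<lambda>i. cmod (a i * x i)) summable_on UNIV"
    by (rule summable_on_comparison_test[OF has_sum_imp_summable[OF gs]]) (use le in auto)
  have eq: "infsum g UNIV = K * (A + 1) / 2"
    using infsumI[OF gs] K(2) by (simp add: power2_eq_square field_simps)
  show "(\<Sum>\<^sub>\<infinity>i. cmod (a i * x i)) \<le> K * (A + 1) / 2"
    unfolding eq[symmetric] by (rule infsum_mono[OF abs has_sum_imp_summable[OF gs]]) (use le in auto)
  then show "cmod (\<Sum>\<^sub>\<infinity>i. a i * x i) \<le> K * (A + 1) / 2"
    using norm_infsum_bound[OF abs] by linarith
qed

text \<open>
  Jensen's inequality for the finite measure \<open>c\<close> gives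
  \<open>\<bar>\<Sum>\<^sub>n c\<^sub>n v\<^sub>n(i)\<bar>\<^sup>2 \<le> (\<Sum> c) \<Sum>\<^sub>n c\<^sub>n \<bar>v\<^sub>n(i)\<bar>\<^sup>2\<close> for each \<open>i\<close>; sum over \<open>i\<close> with weights and exchange the sums.
\<close>

lemma superposition_summable:
  fixes v :: "nat \<Rightarrow> 'i \<Rightarrow> complex" and c :: "nat \<Rightarrow> real"
  assumes W: "\<And>i. W i > 0"
    and V: "\<And>n. ((\<lambda>i. (cmod (v n i))\<^sup>2 * W i) has_sum 1) UNIV"
    and c: "\<And>n. c n \<ge> 0" and C: "c summable_on UNIV"
  shows "(\<lambda>i. (cmod (\<Sum>\<^sub>\<infinity>n. of_real (c n) * v n i))\<^sup>2 * W i) summable_on UNIV"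
proof -
  \<comment> \<open>Adding 1 keeps the total mass positive when all \<open>c n\<close> vanish.\<close>
  define C' where "C' = infsum c UNIV + 1"
  have C'pos: "C' > 0" unfolding C'_def using infsum_nonneg[of UNIV c] c by force
  have vle: "(cmod (v n i))\<^sup>2 * W i \<le> 1" for n i
    using finite_sum_le_has_sum[OF V, of "{i}" n] W by (simp add: less_imp_le)
  have v2: "(cmod (v n i))\<^sup>2 \<le> 1 / W i" for n i
    using vle[of n i] W[of i] by (simp add: field_simps)
  have v1: "cmod (v n i) \<le> 1 / W i + 1" for n i
  proof -
    have "0 \<le> (cmod (v n i) - 1)\<^sup>2" by simp
    then have "2 * cmod (v n i) \<le> (cmod (v n i))\<^sup>2 + 1" by (simp add: power2_eq_square algebra_simps)
    moreover have "0 < 1 / W i" using W by simp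
    ultimately show ?thesis using v2[of n i] by linarith
  qed
  have s1: "(\<lambda>n. c n * cmod (v n i)) summable_on UNIV" for i
    by (rule summable_on_comparison_test[OF summable_on_cmult_left[OF C, of "1 / W i + 1"]])
       (use c v1 in \<open>auto intro: mult_left_mono\<close>)
  have s2: "(\<lambda>n. c n * (cmod (v n i))\<^sup>2) summable_on UNIV" for i
  proof (rule summable_on_comparison_test[OF summable_on_cmult_left[OF C, of "1 / W i"]])
    show "c n * (cmod (v n i))\<^sup>2 \<le> c n * (1 / W i)" for n
      by (rule mult_left_mono[OF v2 c])
  qed (use c in simp)
  define S1 where "S1 i = (\<Sum>\<^sub>\<infinity>n. c n * cmod (v n i))" for i
  define S2 where "S2 i = (\<Sum>\<^sub>\<infinity>n. c n * (cmod (v n i))\<^sup>2)" for i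
  have jensen: "(S1 i)\<^sup>2 \<le> C' * S2 i" for i
  proof -
    \<comment> \<open>\<open>m\<close> is the minimiser of the quadratic \<open>S2 - 2 m S1 + m\<^sup>2 C'\<close>.\<close>
    define m where "m = S1 i / C'"
    have "((\<lambda>n. c n * (cmod (v n i))\<^sup>2 + (- (2 * m)) * (c n * cmod (v n i)) + m\<^sup>2 * c n)
           has_sum (S2 i + (- (2 * m)) * S1 i + m\<^sup>2 * (C' - 1))) UNIV"
      unfolding S1_def S2_def C'_def
      using s1[of i] s2[of i] C by (intro has_sum_add has_sum_cmult_right) auto
    also have "(\<lambda>n. c n * (cmod (v n i))\<^sup>2 + (- (2 * m)) * (c n * cmod (v n i)) + m\<^sup>2 * c n)
        = (\<lambda>n. c n * (cmod (v n i) - m)\<^sup>2)"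
      by (simp add: fun_eq_iff power2_eq_square algebra_simps)
    finally have "0 \<le> S2 i + (- (2 * m)) * S1 i + m\<^sup>2 * (C' - 1)"
      by (rule has_sum_nonneg) (simp add: c)
    moreover have "m\<^sup>2 * (C' - 1) \<le> m\<^sup>2 * C'"
      by (intro mult_left_mono) auto
    ultimately have "0 \<le> S2 i - 2 * m * S1 i + m\<^sup>2 * C'"
      by linarith
    then have "0 \<le> C' * (S2 i - 2 * m * S1 i + m\<^sup>2 * C')"
      using C'pos by (intro mult_nonneg_nonneg) auto
    also have "\<dots> = C' * S2 i - (S1 i)\<^sup>2"
      using C'pos unfolding m_def by (simp add: field_simps power2_eq_square)
    finally show ?thesis by simp
  qed
  have nrm: "cmod (\<Sum>\<^sub>\<infinity>n. of_real (c n) * v n i) \<le> S1 i" for i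
    using norm_infsum_bound[of "\<lambda>n. of_real (c n) * v n i" UNIV] s1[of i] c
    by (simp add: norm_mult S1_def)
  have "(\<lambda>(n, i). c n * ((cmod (v n i))\<^sup>2 * W i)) summable_on UNIV \<times> UNIV"
  proof (rule summable_on_SigmaI)
    show "((\<lambda>i. case (n, i) of (n, i) \<Rightarrow> c n * ((cmod (v n i))\<^sup>2 * W i)) has_sum c n) UNIV" for n
      using has_sum_cmult_right[OF V[of n], of "c n"] by simp
  qed (use C c W in \<open>auto simp: less_imp_le\<close>)
  then have "(\<lambda>(i, n). c n * ((cmod (v n i))\<^sup>2 * W i)) summable_on UNIV \<times> UNIV"
    by (subst summable_on_swap) simp
  then have "(\<lambda>i. \<Sum>\<^sub>\<infinity>n. c n * ((cmod (v n i))\<^sup>2 * W i)) summable_on UNIV"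
    using summable_on_Sigma_banach[of "\<lambda>i n. c n * ((cmod (v n i))\<^sup>2 * W i)" UNIV "\<lambda>_. UNIV"] by simp
  moreover have "(\<Sum>\<^sub>\<infinity>n. c n * ((cmod (v n i))\<^sup>2 * W i)) = S2 i * W i" for i
    unfolding S2_def by (subst infsum_cmult_left[symmetric]) (auto simp: s2 mult.assoc)
  ultimately have "(\<lambda>i. C' * (S2 i * W i)) summable_on UNIV"
    by (intro summable_on_cmult_right) simp
  then show ?thesis
  proof (rule summable_on_comparison_test)
    fix i
    have "(cmod (\<Sum>\<^sub>\<infinity>n. of_real (c n) * v n i))\<^sup>2 \<le> (S1 i)\<^sup>2"
      using nrm by (intro power_mono) auto
    also note jensen
    finally show "(cmod (\<Sum>\<^sub>\<infinity>n. of_real (c n) * v n i))\<^sup>2 * W i \<le> C' * (S2 i * W i)"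
      using W[of i] by (simp add: mult.assoc[symmetric])
  qed (use W in \<open>auto simp: less_imp_le\<close>)
qed

lemma superposition_pairing:
  fixes v :: "nat \<Rightarrow> 'i \<Rightarrow> complex" and c :: "nat \<Rightarrow> real"
  assumes W: "\<And>i. W i > 0"
    and V: "\<And>n. ((\<lambda>i. (cmod (v n i))\<^sup>2 * W i) has_sum 1) UNIV"
    and c: "\<And>n. c n \<ge> 0" and C: "c summable_on UNIV"
    and K: "((\<lambda>i. (cmod (x i))\<^sup>2 / W i) has_sum K\<^sup>2) UNIV" "K > 0"
  shows "(\<Sum>\<^sub>\<infinity>i. (\<Sum>\<^sub>\<infinity>n. of_real (c n) * v n i) * x i) = (\<Sum>\<^sub>\<infinity>n. of_real (c n) * (\<Sum>\<^sub>\<infinity>i. v n i * x i))"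
proof -
  note pair = weighted_pairing_bound[OF W V K]
  define F where "F = (\<lambda>n i. of_real (c n) * (v n i * x i))"
  have "(\<lambda>p. norm (case p of (n, i) \<Rightarrow> F n i)) summable_on UNIV \<times> UNIV"
    unfolding Infinite_Sum.abs_summable_on_Sigma_iff
  proof (intro conjI ballI)
    fix n
    show "(\<lambda>i. norm (case (n, i) of (n, i) \<Rightarrow> F n i)) summable_on UNIV"
      using summable_on_cmult_right[OF pair(1)[of n], of "c n"] c by (simp add: F_def norm_mult)
  next
    have eq: "(\<Sum>\<^sub>\<infinity>i. norm (F n i)) = c n * (\<Sum>\<^sub>\<infinity>i. norm (v n i * x i))" for n
      using c by (subst infsum_cmult_right[symmetric]) (use pair(1)[of n] in \<open>auto simp: F_def norm_mult\<close>)
    have "(\<lambda>n. c n * (\<Sum>\<^sub>\<infinity>i. norm (v n i * x i))) summable_on UNIV"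
      by (rule summable_on_comparison_test[OF summable_on_cmult_left[OF C, of K]])
         (use pair(2) c in \<open>auto intro!: mult_left_mono mult_nonneg_nonneg infsum_nonneg\<close>)
    then show "(\<lambda>n. norm (\<Sum>\<^sub>\<infinity>i. norm (case (n, i) of (n, i) \<Rightarrow> F n i))) summable_on UNIV"
      using c by (simp add: eq abs_mult infsum_nonneg)
  qed
  then have sm: "(\<lambda>(n, i). F n i) summable_on UNIV \<times> UNIV"
    by (rule abs_summable_summable)
  have sm': "(\<lambda>(i, n). F n i) summable_on UNIV \<times> UNIV"
    using sm by (subst summable_on_swap) simp
  have "(\<Sum>\<^sub>\<infinity>n. of_real (c n) * (\<Sum>\<^sub>\<infinity>i. v n i * x i)) = (\<Sum>\<^sub>\<infinity>n. \<Sum>\<^sub>\<infinity>i. F n i)"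
    unfolding F_def by (simp add: infsum_cmult_right abs_summable_summable[OF pair(1)])
  also have "\<dots> = (\<Sum>\<^sub>\<infinity>i. \<Sum>\<^sub>\<infinity>n. F n i)"
    by (rule infsum_swap_banach[OF sm])
  also have "\<dots> = (\<Sum>\<^sub>\<infinity>i. (\<Sum>\<^sub>\<infinity>n. of_real (c n) * v n i) * x i)"
  proof (rule infsum_cong)
    fix i
    have "(\<Sum>\<^sub>\<infinity>n. F n i) = (\<Sum>\<^sub>\<infinity>n. (of_real (c n) * v n i) * x i)"
      by (simp add: F_def mult.assoc)
    also have "\<dots> = (\<Sum>\<^sub>\<infinity>n. of_real (c n) * v n i) * x i"
      by (rule infsum_cmult_left')
    finally show "(\<Sum>\<^sub>\<infinity>n. F n i) = (\<Sum>\<^sub>\<infinity>n. of_real (c n) * v n i) * x i" .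
  qed
  finally show ?thesis by simp
qed

section \<open>Multipliers are bounded\<close>

text \<open>
  The coefficients are chosen recursively. Of the two choices \<open>0\<close> and \<open>5\<^sup>-\<^sup>m\<close> for \<open>c\<^sub>m\<close>, whose
  contributions at \<open>m\<close> differ by \<open>5\<^sup>-\<^sup>m\<close>, at least one makes the partial sum up to \<open>m\<close> at
  least \<open>5\<^sup>-\<^sup>m / 2\<close> in modulus; the later terms together amount to at most \<open>5\<^sup>-\<^sup>m / 4\<close> and cannot
  undo this.
\<close>

lemma gliding_hump:
  fixes u :: "nat \<Rightarrow> nat \<Rightarrow> complex"
  assumes u: "\<And>n m. cmod (u n m) \<le> 1" and diag: "\<And>m. u m m = 1"
  shows "\<exists>c :: nat \<Rightarrow> real. (\<forall>n. 0 \<le> c n) \<and> c summable_on UNIV \<and>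
    (\<forall>m. cmod (\<Sum>\<^sub>\<infinity>n. of_real (c n) * u n m) \<ge> (1/5) ^ m / 4)"
proof -
  define P where "P c m r \<longleftrightarrow> r \<in> {0, (1/5) ^ m} \<and>
    cmod ((\<Sum>n<m. of_real (c n) * u n m) + of_real r) \<ge> (1/5) ^ m / 2" for c :: "nat \<Rightarrow> real" and m r
  have "\<exists>c. \<forall>m. P c m (c m)"
  proof (rule dependent_wf_choice[OF wf_less])
    fix f g :: "nat \<Rightarrow> real" and m r
    assume "\<And>z. (z, m) \<in> {(x, y). x < y} \<Longrightarrow> f z = g z"
    then have "(\<Sum>n<m. of_real (f n) * u n m) = (\<Sum>n<m. of_real (g n) * u n m)"
      by (intro sum.cong) auto
    then show "P f m r = P g m r" by (simp add: P_def)
  next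
    fix m and f :: "nat \<Rightarrow> real"
    let ?s = "\<Sum>n<m. of_real (f n) * u n m"
    have "cmod (of_real ((1/5) ^ m)) \<le> cmod (?s + of_real ((1/5) ^ m)) + cmod ?s"
      by (metis add_diff_cancel_left' norm_triangle_ineq4)
    moreover have "cmod (of_real ((1/5) ^ m)) = (1/5::real) ^ m"
      by (simp only: norm_of_real) simp
    ultimately have "cmod (?s + of_real 0) \<ge> (1/5) ^ m / 2 \<or> cmod (?s + of_real ((1/5) ^ m)) \<ge> (1/5) ^ m / 2"
      by (simp only: of_real_0 add_0_right) linarith
    then show "\<exists>r. P f m r" unfolding P_def by blast
  qed
  then obtain c where c: "\<And>m. P c m (c m)" by blast
  have c0: "0 \<le> c n" and c1: "c n \<le> (1/5) ^ n" for n using c[of n] by (auto simp: P_def)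
  have geo: "summable (\<lambda>n. (1/5::real) ^ n)" by (rule summable_geometric) simp
  have sc: "summable c" by (rule summable_comparison_test'[OF geo]) (use c0 c1 in auto)
  show ?thesis
  proof (intro exI[of _ c] conjI allI)
    show "c summable_on UNIV" by (rule summable_nonneg_imp_summable_on[OF sc c0])
    fix m
    let ?t = "\<lambda>n. of_real (c n) * u n m"
    have tn: "cmod (?t n) \<le> (1/5) ^ n" for n
      using mult_mono[OF c1[of n] u[of n m]] c0[of n] by (simp add: norm_mult)
    have st: "summable (\<lambda>n. norm (?t n))" by (rule summable_comparison_test'[OF geo]) (use tn in auto)
    have "(?t has_sum suminf ?t) UNIV"
      by (rule norm_summable_imp_has_sum[OF st summable_sums[OF summable_norm_cancel[OF st]]])
    then have "(\<Sum>\<^sub>\<infinity>n. ?t n) = suminf ?t" by (rule infsumI)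
    also have "\<dots> = (\<Sum>n. ?t (n + Suc m)) + (\<Sum>n<Suc m. ?t n)"
      by (rule suminf_split_initial_segment[OF summable_norm_cancel[OF st]])
    finally have eq: "(\<Sum>\<^sub>\<infinity>n. ?t n) = (\<Sum>n. ?t (n + Suc m)) + ((\<Sum>n<m. ?t n) + of_real (c m))"
      using diag[of m] by simp
    have "cmod (\<Sum>n. ?t (n + Suc m)) \<le> (\<Sum>n. (1/5) ^ n * (1/5) ^ Suc m)"
    proof (rule norm_suminf_le)
      show "cmod (?t (n + Suc m)) \<le> (1/5) ^ n * (1/5) ^ Suc m" for n
        using tn[of "n + Suc m"] by (simp only: power_add)
    qed (rule summable_mult2[OF geo])
    also have "\<dots> = (1/5) ^ m / 4"
      using suminf_mult2[OF geo, of "(1/5) ^ Suc m"] suminf_geometric[of "1/5::real"] by simp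
    finally have "cmod (\<Sum>n. ?t (n + Suc m)) \<le> (1/5) ^ m / 4" .
    moreover have "cmod ((\<Sum>n<m. ?t n) + of_real (c m)) \<ge> (1/5) ^ m / 2"
      using c[of m] by (simp add: P_def)
    ultimately show "cmod (\<Sum>\<^sub>\<infinity>n. ?t n) \<ge> (1/5) ^ m / 4"
      unfolding eq
      using norm_diff_ineq[of "(\<Sum>n<m. ?t n) + of_real (c m)" "\<Sum>n. ?t (n + Suc m)"]
      by (simp add: add.commute)
  qed (use c0 in auto)
qed

text \<open>
  A uniform boundedness principle for multipliers: \<open>X p\<close> is the functional of evaluation at \<open>p\<close>,
  and \<open>\<phi>\<close> maps the weighted space into itself as a multiplier of the resulting functions on \<open>S\<close>.
\<close>

lemma multiplier_bounded:
  fixes X :: "'p \<Rightarrow> 'i \<Rightarrow> complex" and W :: "'i \<Rightarrow> real" and \<phi> :: "'p \<Rightarrow> complex"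
  assumes W: "\<And>i. W i > 0"
    and X: "\<And>p. p \<in> S \<Longrightarrow> (\<lambda>i. (cmod (X p i))\<^sup>2 / W i) summable_on UNIV"
    and nz: "\<And>p. p \<in> S \<Longrightarrow> \<exists>i. X p i \<noteq> 0"
    and mult: "\<And>a. (\<lambda>i. (cmod (a i))\<^sup>2 * W i) summable_on UNIV \<Longrightarrow>
      \<exists>b. (\<lambda>i. (cmod (b i))\<^sup>2 * W i) summable_on UNIV \<and>
          (\<forall>p\<in>S. \<phi> p * (\<Sum>\<^sub>\<infinity>i. a i * X p i) = (\<Sum>\<^sub>\<infinity>i. b i * X p i))"
  shows "bounded (\<phi> ` S)"
proof (rule ccontr)
  assume unb: "\<not> bounded (\<phi> ` S)"
  have "\<exists>p. p \<in> S \<and> cmod (\<phi> p) \<ge> real m * 5 ^ m" for m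
  proof (rule ccontr)
    assume "\<not> ?thesis"
    then have "\<forall>x\<in>\<phi> ` S. norm x \<le> real m * 5 ^ m" by (auto simp: not_le less_imp_le)
    then show False using unb unfolding bounded_iff by blast
  qed
  then obtain P where P: "\<And>m. P m \<in> S" "\<And>m. cmod (\<phi> (P m)) \<ge> real m * 5 ^ m" by metis
  define K where "K m = sqrt (\<Sum>\<^sub>\<infinity>i. (cmod (X (P m) i))\<^sup>2 / W i)" for m
  have inf_pos: "(\<Sum>\<^sub>\<infinity>i. (cmod (X (P m) i))\<^sup>2 / W i) > 0" for m
  proof -
    obtain i where i: "X (P m) i \<noteq> 0" using nz[OF P(1)] by blast
    have "0 < (cmod (X (P m) i))\<^sup>2 / W i" using i W by simp
    also have "\<dots> \<le> (\<Sum>\<^sub>\<infinity>i. (cmod (X (P m) i))\<^sup>2 / W i)"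
      using finite_sum_le_infsum[OF X[OF P(1)], of "{i}" m] W by (simp add: less_imp_le)
    finally show ?thesis .
  qed
  then have Kpos: "K m > 0" for m unfolding K_def by simp
  have K: "((\<lambda>i. (cmod (X (P m) i))\<^sup>2 / W i) has_sum (K m)\<^sup>2) UNIV" for m
    unfolding K_def using inf_pos[of m] X[OF P(1)] by simp
  \<comment> \<open>\<open>v n\<close> is the reproducing kernel at \<open>P n\<close>, normalised to have norm 1.\<close>
  define v where "v n i = cnj (X (P n) i) / of_real (W i * K n)" for n i
  have v: "((\<lambda>i. (cmod (v n i))\<^sup>2 * W i) has_sum 1) UNIV" for n
  proof -
    have "((\<lambda>i. 1 / (K n)\<^sup>2 * ((cmod (X (P n) i))\<^sup>2 / W i)) has_sum (1 / (K n)\<^sup>2 * (K n)\<^sup>2)) UNIV"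
      by (intro has_sum_cmult_right K)
    moreover have "1 / (K n)\<^sup>2 * ((cmod (X (P n) i))\<^sup>2 / W i) = (cmod (v n i))\<^sup>2 * W i" for i
      using W[of i] Kpos[of n] by (simp add: v_def norm_divide norm_mult power_divide power_mult_distrib power2_eq_square)
    ultimately show ?thesis using Kpos[of n] by simp
  qed
  define u where "u n m = (\<Sum>\<^sub>\<infinity>i. v n i * X (P m) i) / of_real (K m)" for n m
  have u1: "cmod (u n m) \<le> 1" for n m
    using weighted_pairing_bound(3)[OF W v K Kpos, of n m] Kpos[of m]
    by (simp add: u_def norm_divide divide_le_eq)
  have diag: "u m m = 1" for m
  proof -
    have "((\<lambda>i. of_real (1 / K m * ((cmod (X (P m) i))\<^sup>2 / W i)) :: complex) has_sum of_real (1 / K m * (K m)\<^sup>2)) UNIV"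
      by (intro has_sum_of_real has_sum_cmult_right K)
    moreover have "of_real (1 / K m * ((cmod (X (P m) i))\<^sup>2 / W i)) = v m i * X (P m) i" for i
      using complex_norm_square[of "X (P m) i"] by (simp add: v_def mult_ac)
    ultimately have "((\<lambda>i. v m i * X (P m) i) has_sum of_real (K m)) UNIV"
      using Kpos[of m] by (simp add: power2_eq_square)
    from infsumI[OF this] show ?thesis using Kpos[of m] by (simp add: u_def)
  qed
  obtain c where c: "\<And>n. 0 \<le> c n" "c summable_on UNIV"
    "\<And>m. cmod (\<Sum>\<^sub>\<infinity>n. of_real (c n) * u n m) \<ge> (1/5) ^ m / 4"
    using gliding_hump[of u, OF u1 diag] by blast
  define a where "a i = (\<Sum>\<^sub>\<infinity>n. of_real (c n) * v n i)" for i
  have "(\<lambda>i. (cmod (a i))\<^sup>2 * W i) summable_on UNIV"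
    unfolding a_def by (rule superposition_summable[OF W v c(1,2)])
  from mult[OF this] obtain b where b: "(\<lambda>i. (cmod (b i))\<^sup>2 * W i) summable_on UNIV"
    "\<And>p. p \<in> S \<Longrightarrow> \<phi> p * (\<Sum>\<^sub>\<infinity>i. a i * X p i) = (\<Sum>\<^sub>\<infinity>i. b i * X p i)" by blast
  define B where "B = (\<Sum>\<^sub>\<infinity>i. (cmod (b i))\<^sup>2 * W i)"
  have Bs: "((\<lambda>i. (cmod (b i))\<^sup>2 * W i) has_sum B) UNIV" unfolding B_def using b(1) by simp
  have "real m \<le> 2 * (B + 1)" for m
  proof -
    have "(\<Sum>\<^sub>\<infinity>i. a i * X (P m) i) = (\<Sum>\<^sub>\<infinity>n. of_real (c n) * (\<Sum>\<^sub>\<infinity>i. v n i * X (P m) i))"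
      unfolding a_def by (rule superposition_pairing[OF W v c(1,2) K Kpos])
    also have "\<dots> = (\<Sum>\<^sub>\<infinity>n. (of_real (c n) * u n m) * of_real (K m))"
      using Kpos[of m] by (simp add: u_def)
    also have "\<dots> = (\<Sum>\<^sub>\<infinity>n. of_real (c n) * u n m) * of_real (K m)"
      by (rule infsum_cmult_left')
    finally have eq: "cmod (\<Sum>\<^sub>\<infinity>i. a i * X (P m) i) = cmod (\<Sum>\<^sub>\<infinity>n. of_real (c n) * u n m) * K m"
      using Kpos[of m] by (simp add: norm_mult)
    have "(real m * 5 ^ m) * ((1/5) ^ m / 4 * K m) \<le> cmod (\<phi> (P m)) * cmod (\<Sum>\<^sub>\<infinity>i. a i * X (P m) i)"
      unfolding eq using Kpos[of m] by (intro mult_mono P(2) c(3)) auto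
    also have "\<dots> = cmod (\<Sum>\<^sub>\<infinity>i. b i * X (P m) i)"
      using b(2)[OF P(1), of m] by (metis norm_mult)
    also have "\<dots> \<le> K m * (B + 1) / 2"
      by (rule weighted_pairing_bound(3)[OF W Bs K Kpos])
    finally have "K m * real m \<le> K m * (2 * (B + 1))"
      by (simp add: power_one_over field_simps)
    then show ?thesis using Kpos[of m] by simp
  qed
  then show False using reals_Archimedean2[of "2 * (B + 1)"] by (meson not_le)
qed

section \<open>Parseval's identity over roots of unity\<close>

text \<open>
  Averaging over \<open>Q\<close>-th roots of unity is exact for polynomials of degree below \<open>Q\<close>, so no
  integration over circles is needed.
\<close>

lemma roots_of_unity_parseval:
  fixes d :: "nat \<Rightarrow> complex"
  assumes Q: "Q > 0"
  defines "\<omega> \<equiv> cis (2 * pi / real Q)"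
  shows "(\<Sum>s<Q. (cmod (\<Sum>k<Q. d k * \<omega> ^ (s * k)))\<^sup>2) = real Q * (\<Sum>k<Q. (cmod (d k))\<^sup>2)"
proof -
  have orth: "(\<Sum>s<Q. (\<omega> ^ k * cnj (\<omega> ^ j)) ^ s) = (if j = k then of_nat Q else 0)"
    if "k < Q" "j < Q" for j k
  proof (cases "j = k")
    case True
    have "\<omega> ^ k * cnj (\<omega> ^ k) = 1"
      by (metis \<omega>_def complex_norm_square norm_cis norm_power of_real_1 power_one)
    then show ?thesis using True by simp
  next
    case False
    let ?x = "\<omega> ^ k * cnj (\<omega> ^ j)"
    have pow: "\<omega> ^ n = exp (2 * of_real pi * \<i> * of_nat n / of_nat Q)" for n
      unfolding \<omega>_def cis_conv_exp exp_of_nat_mult[symmetric] by (simp add: mult_ac)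
    have ne: "\<omega> ^ k \<noteq> \<omega> ^ j"
      unfolding pow using complex_root_unity_eq[of Q k j] Q False that by simp
    have jj: "\<omega> ^ j * cnj (\<omega> ^ j) = 1"
      by (metis \<omega>_def complex_norm_square norm_cis norm_power of_real_1 power_one)
    have "?x \<noteq> 1"
    proof
      assume "?x = 1"
      then have "\<omega> ^ j = ?x * \<omega> ^ j" by (simp only: mult_1_left)
      also have "\<dots> = \<omega> ^ k * (\<omega> ^ j * cnj (\<omega> ^ j))" by (simp only: mult_ac)
      also have "\<dots> = \<omega> ^ k" by (simp only: jj mult_1_right)
      finally show False using ne by simp
    qed
    moreover have "?x ^ Q = 1"
    proof -
      have "\<omega> ^ Q = 1" unfolding \<omega>_def Complex.DeMoivre using Q by simp
      then have "(\<omega> ^ n) ^ Q = 1" for n by (metis mult.commute power_mult power_one)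
      moreover have "?x ^ Q = (\<omega> ^ k) ^ Q * cnj ((\<omega> ^ j) ^ Q)"
        by (simp only: power_mult_distrib complex_cnj_power)
      ultimately show ?thesis by (simp only: complex_cnj_one mult_1_right)
    qed
    ultimately show ?thesis using False by (simp add: geometric_sum)
  qed
  have "of_real (\<Sum>s<Q. (cmod (\<Sum>k<Q. d k * \<omega> ^ (s * k)))\<^sup>2)
      = (\<Sum>s<Q. (\<Sum>k<Q. d k * \<omega> ^ (s * k)) * cnj (\<Sum>k<Q. d k * \<omega> ^ (s * k)))"
    by (simp only: of_real_sum complex_norm_square)
  also have "\<dots> = (\<Sum>s<Q. \<Sum>k<Q. \<Sum>j<Q. (d k * cnj (d j)) * (\<omega> ^ k * cnj (\<omega> ^ j)) ^ s)"
    unfolding cnj_sum sum_product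
    by (intro sum.cong refl) (simp add: power_mult_distrib power_mult[symmetric] mult_ac)
  also have "\<dots> = (\<Sum>k<Q. \<Sum>j<Q. \<Sum>s<Q. (d k * cnj (d j)) * (\<omega> ^ k * cnj (\<omega> ^ j)) ^ s)"
    by (rule trans[OF sum.swap]) (rule sum.cong[OF refl sum.swap])
  also have "\<dots> = (\<Sum>k<Q. \<Sum>j<Q. (d k * cnj (d j)) * (if j = k then of_nat Q else 0))"
    unfolding sum_distrib_left[symmetric] by (intro sum.cong refl, subst orth) auto
  also have "\<dots> = (\<Sum>k<Q. (d k * cnj (d k)) * of_nat Q)"
    by (intro sum.cong refl) (simp add: if_distrib[of "\<lambda>x. _ * x"] cong: if_cong)
  also have "\<dots> = of_real (real Q * (\<Sum>k<Q. (cmod (d k))\<^sup>2))"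
    by (simp only: of_real_mult of_real_sum complex_norm_square of_real_of_nat_eq sum_distrib_left mult.commute)
  finally show ?thesis unfolding of_real_eq_iff .
qed

lemma roots_of_unity_parseval2:
  fixes d :: "nat \<Rightarrow> nat \<Rightarrow> complex"
  assumes Q: "Q > 0"
  defines "\<omega> \<equiv> cis (2 * pi / real Q)"
  shows "(\<Sum>s<Q. \<Sum>t<Q. (cmod (\<Sum>k<Q. \<Sum>l<Q. d k l * \<omega> ^ (s * k) * \<omega> ^ (t * l)))\<^sup>2)
       = (real Q)\<^sup>2 * (\<Sum>k<Q. \<Sum>l<Q. (cmod (d k l))\<^sup>2)"
proof -
  have "(\<Sum>k<Q. \<Sum>l<Q. d k l * \<omega> ^ (s * k) * \<omega> ^ (t * l))
      = (\<Sum>l<Q. (\<Sum>k<Q. d k l * \<omega> ^ (s * k)) * \<omega> ^ (t * l))" for s t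
    by (subst sum.swap) (simp add: sum_distrib_right)
  then have "(\<Sum>s<Q. \<Sum>t<Q. (cmod (\<Sum>k<Q. \<Sum>l<Q. d k l * \<omega> ^ (s * k) * \<omega> ^ (t * l)))\<^sup>2)
      = (\<Sum>s<Q. real Q * (\<Sum>l<Q. (cmod (\<Sum>k<Q. d k l * \<omega> ^ (s * k)))\<^sup>2))"
    unfolding \<omega>_def by (simp add: roots_of_unity_parseval[OF Q])
  also have "\<dots> = real Q * (\<Sum>l<Q. \<Sum>s<Q. (cmod (\<Sum>k<Q. d k l * \<omega> ^ (s * k)))\<^sup>2)"
    unfolding sum_distrib_left[symmetric] by (subst sum.swap) simp
  also have "\<dots> = real Q * (\<Sum>l<Q. real Q * (\<Sum>k<Q. (cmod (d k l))\<^sup>2))"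
    unfolding \<omega>_def by (simp add: roots_of_unity_parseval[OF Q])
  also have "\<dots> = (real Q)\<^sup>2 * (\<Sum>k<Q. \<Sum>l<Q. (cmod (d k l))\<^sup>2)"
    unfolding sum_distrib_left[symmetric] by (subst sum.swap) (simp add: power2_eq_square)
  finally show ?thesis .
qed

section \<open>Double power series on the bidisc\<close>

definition power_series2 :: "(nat \<times> nat \<Rightarrow> complex) \<Rightarrow> (complex \<times> complex \<Rightarrow> complex) \<Rightarrow> bool" where
  "power_series2 a f \<longleftrightarrow>
     (\<forall>(z, w) \<in> bidisc. ((\<lambda>(k, l). a (k, l) * z ^ k * w ^ l) has_sum f (z, w)) UNIV)"

lemma power_series2D:
  assumes "power_series2 a f" "cmod z < 1" "cmod w < 1"
  shows "((\<lambda>(k, l). a (k, l) * z ^ k * w ^ l) has_sum f (z, w)) UNIV"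
  using assms by (auto simp: power_series2_def bidisc_def)

lemma power_series2_abs_summable:
  assumes "power_series2 a f" "0 \<le> r" "r < 1" "0 \<le> s" "s < 1"
  shows "(\<lambda>(k, l). cmod (a (k, l)) * r ^ k * s ^ l) summable_on UNIV"
proof -
  have "(\<lambda>(k, l). a (k, l) * of_real r ^ k * of_real s ^ l) summable_on UNIV"
    by (rule has_sum_imp_summable[OF power_series2D[OF assms(1)]]) (use assms in auto)
  then have "(\<lambda>x. cmod (case x of (k, l) \<Rightarrow> a (k, l) * of_real r ^ k * of_real s ^ l)) summable_on UNIV"
    by (simp add: summable_on_iff_abs_summable_on_complex)
  then show ?thesis
    by (rule summable_on_cong[THEN iffD1, rotated])
       (use assms in \<open>auto simp: norm_mult norm_power\<close>)
qed

text \<open>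
  On the torus of radius \<open>r\<close> the series \<open>g\<close> is within \<open>e\<close> of a partial sum, to which the discrete
  Parseval identity applies; there the partial sum is at most \<open>C \<bar>h\<bar> + e\<close>, where \<open>h\<close> is the
  dominating polynomial.
\<close>

lemma dominated_by_polynomial_imp_coeffs_le_circle:
  assumes g: "power_series2 b g"
    and dom: "\<And>z w. cmod z < 1 \<Longrightarrow> cmod w < 1 \<Longrightarrow>
      cmod (g (z, w)) \<le> C * cmod (\<Sum>k\<le>N. \<Sum>l\<le>M. a (k, l) * z ^ k * w ^ l)"
    and C: "C \<ge> 0" and r: "0 < r" "r < 1" and e: "e > 0"
  shows "(\<Sum>k\<le>N. \<Sum>l\<le>M. (cmod (b (k, l)) * r ^ k * r ^ l)\<^sup>2)
    \<le> C\<^sup>2 * (\<Sum>k\<le>N. \<Sum>l\<le>M. (cmod (a (k, l)))\<^sup>2) + e * (2 * C * (\<Sum>k\<le>N. \<Sum>l\<le>M. cmod (a (k, l))) + e)"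
proof -
  let ?H = "\<Sum>k\<le>N. \<Sum>l\<le>M. cmod (a (k, l))"
  define \<beta> where "\<beta> = (\<lambda>(k, l). cmod (b (k, l)) * r ^ k * r ^ l)"
  have sb: "\<beta> summable_on UNIV"
    unfolding \<beta>_def by (rule power_series2_abs_summable[OF g]) (use r in auto)
  have b0: "\<beta> p \<ge> 0" for p using r by (cases p) (simp add: \<beta>_def)
  obtain F where F: "finite F" "dist (sum \<beta> F) (infsum \<beta> UNIV) \<le> e"
    using infsum_finite_approximation[OF sb e] by auto
  define Q where "Q = Suc (Max (insert N (insert M (fst ` F \<union> snd ` F))))"
  have bound: "n < Q" if "n \<in> insert N (insert M (fst ` F \<union> snd ` F))" for n
    using that F(1) unfolding Q_def by (intro le_imp_less_Suc Max_ge) auto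
  have Q: "Q > 0" "N < Q" "M < Q" using bound by (auto simp: Q_def)
  \<comment> \<open>\<open>Q\<close> exceeds every index that occurs, so the \<open>Q\<close>-th roots of unity separate the exponents in \<open>R\<close>.\<close>
  define R where "R = {..<Q} \<times> {..<Q}"
  have FR: "F \<subseteq> R"
  proof
    fix p assume "p \<in> F"
    then have "fst p < Q" "snd p < Q" by (auto intro!: bound)
    then show "p \<in> R" by (cases p) (simp add: R_def)
  qed
  have finR: "finite R" by (simp add: R_def)
  have tail: "infsum \<beta> UNIV - sum \<beta> R \<le> e"
    using sum_mono2[OF finR FR, of \<beta>] b0 F(2) by (auto simp: dist_real_def)
  have tail_sum: "(\<beta> has_sum (infsum \<beta> UNIV - sum \<beta> R)) (UNIV - R)"
    using sb finR by (intro has_sum_Diff) auto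
  define \<omega> where "\<omega> = cis (2 * pi / real Q)"
  let ?G = "\<lambda>s t. \<Sum>k<Q. \<Sum>l<Q. (b (k, l) * of_real (r ^ k * r ^ l)) * \<omega> ^ (s * k) * \<omega> ^ (t * l)"
  define a' where "a' k l = (if k \<le> N \<and> l \<le> M then a (k, l) * of_real (r ^ k * r ^ l) else 0)" for k l
  let ?h = "\<lambda>s t. \<Sum>k<Q. \<Sum>l<Q. a' k l * \<omega> ^ (s * k) * \<omega> ^ (t * l)"
  have G_le: "(cmod (?G s t))\<^sup>2 \<le> C\<^sup>2 * (cmod (?h s t))\<^sup>2 + e * (2 * C * ?H + e)" for s t
  proof -
    define z where "z = of_real r * \<omega> ^ s"
    define w where "w = of_real r * \<omega> ^ t"
    have nz: "cmod z = r" "cmod w = r" using r by (simp_all add: z_def w_def \<omega>_def norm_mult norm_power)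
    have tm: "x * z ^ k * w ^ l = (x * of_real (r ^ k * r ^ l)) * \<omega> ^ (s * k) * \<omega> ^ (t * l)" for x k l
      by (simp add: z_def w_def power_mult_distrib power_mult)
    have G: "?G s t = (\<Sum>(k, l)\<in>R. b (k, l) * z ^ k * w ^ l)"
      unfolding tm R_def sum.cartesian_product ..
    have sub: "{..<Q} \<inter> {k. k \<le> N} = {..N}" "{..<Q} \<inter> {k. k \<le> M} = {..M}" using Q by auto
    have h: "?h s t = (\<Sum>k\<le>N. \<Sum>l\<le>M. a (k, l) * z ^ k * w ^ l)"
    proof -
      have "?h s t = (\<Sum>k<Q. if k \<le> N then (\<Sum>l<Q. if l \<le> M then a (k, l) * z ^ k * w ^ l else 0) else 0)"
        unfolding tm a'_def by (intro sum.cong refl) (auto intro!: sum.cong)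
      then show ?thesis by (simp only: sum.inter_restrict[symmetric] sum.If_cases finite_lessThan sub sum.neutral_const add_0_right)
    qed
    have "((\<lambda>(k, l). b (k, l) * z ^ k * w ^ l) has_sum (g (z, w) - ?G s t)) (UNIV - R)"
      unfolding G using power_series2D[OF g, of z w] nz r finR by (intro has_sum_Diff) auto
    then have "cmod (g (z, w) - ?G s t) \<le> infsum \<beta> UNIV - sum \<beta> R"
      by (rule norm_infsum_le[OF _ tail_sum]) (auto simp: \<beta>_def norm_mult norm_power nz)
    then have "cmod (?G s t) \<le> cmod (g (z, w)) + e"
      using tail norm_triangle_sub[of "?G s t" "g (z, w)"] by (simp add: norm_minus_commute)
    also have "\<dots> \<le> C * cmod (?h s t) + e"
      unfolding h using dom[of z w] nz r by simp
    finally have "(cmod (?G s t))\<^sup>2 \<le> (C * cmod (?h s t) + e)\<^sup>2"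
      by (intro power_mono) auto
    also have "\<dots> = C\<^sup>2 * (cmod (?h s t))\<^sup>2 + e * (2 * C * cmod (?h s t) + e)"
      by (simp add: power2_eq_square algebra_simps)
    also have "\<dots> \<le> C\<^sup>2 * (cmod (?h s t))\<^sup>2 + e * (2 * C * ?H + e)"
    proof -
      have "cmod (?h s t) \<le> (\<Sum>k\<le>N. \<Sum>l\<le>M. cmod (a (k, l) * z ^ k * w ^ l))"
        unfolding h by (intro order.trans[OF norm_sum] sum_mono norm_sum)
      also have "\<dots> \<le> ?H"
      proof (intro sum_mono)
        fix k l
        have "r ^ k * r ^ l \<le> 1" using r by (intro mult_le_one power_le_one) auto
        then show "cmod (a (k, l) * z ^ k * w ^ l) \<le> cmod (a (k, l))"
          using nz mult_left_mono[of "r ^ k * r ^ l" 1 "cmod (a (k, l))"] by (simp add: norm_mult norm_power mult.assoc)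
      qed
      finally show ?thesis using C e by (intro add_left_mono mult_left_mono add_right_mono) auto
    qed
    finally show ?thesis .
  qed
  have split_sum: "(\<Sum>s<Q. \<Sum>t<Q. c * X s t + K) = c * (\<Sum>s<Q. \<Sum>t<Q. X s t) + (real Q)\<^sup>2 * K"
    for c K :: real and X :: "nat \<Rightarrow> nat \<Rightarrow> real"
    by (simp add: sum.distrib sum_distrib_left power2_eq_square)
  have "(real Q)\<^sup>2 * (\<Sum>k<Q. \<Sum>l<Q. (cmod (b (k, l) * of_real (r ^ k * r ^ l)))\<^sup>2) = (\<Sum>s<Q. \<Sum>t<Q. (cmod (?G s t))\<^sup>2)"
    unfolding \<omega>_def by (rule roots_of_unity_parseval2[OF Q(1), symmetric])
  also have "\<dots> \<le> (\<Sum>s<Q. \<Sum>t<Q. C\<^sup>2 * (cmod (?h s t))\<^sup>2 + e * (2 * C * ?H + e))"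
    by (intro sum_mono G_le)
  also have "\<dots> = C\<^sup>2 * (\<Sum>s<Q. \<Sum>t<Q. (cmod (?h s t))\<^sup>2) + (real Q)\<^sup>2 * (e * (2 * C * ?H + e))"
    by (rule split_sum)
  also have "(\<Sum>s<Q. \<Sum>t<Q. (cmod (?h s t))\<^sup>2) = (real Q)\<^sup>2 * (\<Sum>k<Q. \<Sum>l<Q. (cmod (a' k l))\<^sup>2)"
    unfolding \<omega>_def by (rule roots_of_unity_parseval2[OF Q(1)])
  finally have "(real Q)\<^sup>2 * (\<Sum>k<Q. \<Sum>l<Q. (cmod (b (k, l) * of_real (r ^ k * r ^ l)))\<^sup>2)
      \<le> (real Q)\<^sup>2 * (C\<^sup>2 * (\<Sum>k<Q. \<Sum>l<Q. (cmod (a' k l))\<^sup>2) + e * (2 * C * ?H + e))"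
    by (simp only: distrib_left mult_ac)
  then have main: "(\<Sum>k<Q. \<Sum>l<Q. (cmod (b (k, l) * of_real (r ^ k * r ^ l)))\<^sup>2)
      \<le> C\<^sup>2 * (\<Sum>k<Q. \<Sum>l<Q. (cmod (a' k l))\<^sup>2) + e * (2 * C * ?H + e)"
    using Q(1) by (simp only: mult_le_cancel_left_pos zero_less_power of_nat_0_less_iff)
  have "(\<Sum>k\<le>N. \<Sum>l\<le>M. (cmod (b (k, l)) * r ^ k * r ^ l)\<^sup>2)
      \<le> (\<Sum>k<Q. \<Sum>l<Q. (cmod (b (k, l) * of_real (r ^ k * r ^ l)))\<^sup>2)"
  proof -
    have "(\<Sum>k\<le>N. \<Sum>l\<le>M. (cmod (b (k, l)) * r ^ k * r ^ l)\<^sup>2)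
        \<le> (\<Sum>k\<le>N. \<Sum>l<Q. (cmod (b (k, l)) * r ^ k * r ^ l)\<^sup>2)"
      using Q by (intro sum_mono sum_mono2) auto
    also have "\<dots> \<le> (\<Sum>k<Q. \<Sum>l<Q. (cmod (b (k, l)) * r ^ k * r ^ l)\<^sup>2)"
      using Q by (intro sum_mono2 sum_nonneg) auto
    also have "\<dots> = (\<Sum>k<Q. \<Sum>l<Q. (cmod (b (k, l) * of_real (r ^ k * r ^ l)))\<^sup>2)"
      using r by (simp add: norm_mult norm_power mult.assoc)
    finally show ?thesis .
  qed
  moreover have "(\<Sum>k<Q. \<Sum>l<Q. (cmod (a' k l))\<^sup>2) \<le> (\<Sum>k\<le>N. \<Sum>l\<le>M. (cmod (a (k, l)))\<^sup>2)"
  proof -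
    have "(\<Sum>k<Q. \<Sum>l<Q. (cmod (a' k l))\<^sup>2) = (\<Sum>k\<le>N. \<Sum>l<Q. (cmod (a' k l))\<^sup>2)"
      using Q by (intro sum.mono_neutral_right) (auto simp: a'_def)
    also have "\<dots> = (\<Sum>k\<le>N. \<Sum>l\<le>M. (cmod (a' k l))\<^sup>2)"
      using Q by (intro sum.cong refl sum.mono_neutral_right) (auto simp: a'_def)
    also have "\<dots> \<le> (\<Sum>k\<le>N. \<Sum>l\<le>M. (cmod (a (k, l)))\<^sup>2)"
    proof (intro sum_mono power_mono)
      fix k l assume "k \<in> {..N}" "l \<in> {..M}"
      have "r ^ k * r ^ l \<le> 1" using r by (intro mult_le_one power_le_one) auto
      then show "cmod (a' k l) \<le> cmod (a (k, l))"
        using r mult_left_mono[of "r ^ k * r ^ l" 1 "cmod (a (k, l))"] by (simp add: a'_def norm_mult norm_power)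
    qed auto
    finally show ?thesis .
  qed
  then have "C\<^sup>2 * (\<Sum>k<Q. \<Sum>l<Q. (cmod (a' k l))\<^sup>2) \<le> C\<^sup>2 * (\<Sum>k\<le>N. \<Sum>l\<le>M. (cmod (a (k, l)))\<^sup>2)"
    by (intro mult_left_mono) auto
  ultimately show ?thesis using main by linarith
qed

text \<open>
  The preceding bound with \<open>e\<close> tending to 0, and then \<open>r\<close> tending to 1.
\<close>

lemma dominated_by_polynomial_imp_coeffs_le:
  assumes g: "power_series2 b g"
    and dom: "\<And>z w. cmod z < 1 \<Longrightarrow> cmod w < 1 \<Longrightarrow>
      cmod (g (z, w)) \<le> C * cmod (\<Sum>k\<le>N. \<Sum>l\<le>M. a (k, l) * z ^ k * w ^ l)"
    and C: "C \<ge> 0"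
  shows "(\<Sum>k\<le>N. \<Sum>l\<le>M. (cmod (b (k, l)))\<^sup>2) \<le> C\<^sup>2 * (\<Sum>k\<le>N. \<Sum>l\<le>M. (cmod (a (k, l)))\<^sup>2)"
proof -
  let ?H = "\<Sum>k\<le>N. \<Sum>l\<le>M. cmod (a (k, l))"
  let ?Y = "C\<^sup>2 * (\<Sum>k\<le>N. \<Sum>l\<le>M. (cmod (a (k, l)))\<^sup>2)"
  let ?X = "\<lambda>r::real. \<Sum>k\<le>N. \<Sum>l\<le>M. (cmod (b (k, l)) * r ^ k * r ^ l)\<^sup>2"
  have le: "?X r \<le> ?Y" if r: "0 < r" "r < 1" for r
  proof -
    have "((\<lambda>e. ?Y + e * (2 * C * ?H + e)) \<longlongrightarrow> ?Y + 0 * (2 * C * ?H + 0)) (at_right 0)"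
      by (intro tendsto_intros)
    moreover have "\<forall>\<^sub>F e in at_right 0. ?X r \<le> ?Y + e * (2 * C * ?H + e)"
      using dominated_by_polynomial_imp_coeffs_le_circle[OF g dom C r]
      by (auto simp: eventually_at_right_field intro!: exI[of _ 1])
    ultimately show ?thesis by (intro tendsto_lowerbound[where F="at_right 0"]) auto
  qed
  have "(?X \<longlongrightarrow> ?X 1) (at_left 1)"
    by (intro tendsto_intros)
  moreover have "\<forall>\<^sub>F r in at_left 1. ?X r \<le> ?Y"
    using le by (auto simp: eventually_at_left_field intro!: exI[of _ 0])
  ultimately have "?X 1 \<le> ?Y" by (intro tendsto_upperbound[where F="at_left 1"]) auto
  then show ?thesis by simp
qed

lemma has_sum_product_abs:
  fixes f :: "'a \<Rightarrow> complex" and g :: "'b \<Rightarrow> complex"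
  assumes f: "(f has_sum s) UNIV" and g: "(g has_sum t) UNIV"
  shows "((\<lambda>(x, y). f x * g y) has_sum (s * t)) (UNIV \<times> UNIV)"
proof (rule has_sum_SigmaI)
  have af: "(\<lambda>x. norm (f x)) summable_on UNIV" and ag: "(\<lambda>x. norm (g x)) summable_on UNIV"
    using f g by (simp_all add: has_sum_imp_summable flip: summable_on_iff_abs_summable_on_complex)
  have "(\<lambda>p. norm (case p of (x, y) \<Rightarrow> f x * g y)) summable_on UNIV \<times> UNIV"
    unfolding Infinite_Sum.abs_summable_on_Sigma_iff
    using af ag by (auto simp: norm_mult infsum_cmult_right abs_mult infsum_nonneg
        intro!: summable_on_cmult_right summable_on_cmult_left)
  then show "(\<lambda>(x, y). f x * g y) summable_on UNIV \<times> UNIV"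
    by (rule abs_summable_summable)
  show "((\<lambda>x. f x * t) has_sum s * t) UNIV" by (rule has_sum_cmult_left[OF f])
  show "((\<lambda>y. case (x, y) of (x, y) \<Rightarrow> f x * g y) has_sum f x * t) UNIV" for x
    by (simp add: has_sum_cmult_right[OF g])
qed

definition convolution2 :: "(nat \<times> nat \<Rightarrow> complex) \<Rightarrow> (nat \<times> nat \<Rightarrow> complex) \<Rightarrow> nat \<times> nat \<Rightarrow> complex" where
  "convolution2 c a = (\<lambda>(k, l). \<Sum>i\<le>k. \<Sum>j\<le>l. c (i, j) * a (k - i, l - j))"

text \<open>
  The Cauchy product: the quadruples of exponents are regrouped by their sums, which absolute
  convergence permits.
\<close>

lemma power_series2_mult:
  assumes "power_series2 c \<phi>" "power_series2 a f"
  shows "power_series2 (convolution2 c a) (\<lambda>p. \<phi> p * f p)"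
  unfolding power_series2_def
proof safe
  fix z w assume zw: "(z, w) \<in> bidisc"
  define F where "F = (\<lambda>(k, l). c (k, l) * z ^ k * w ^ l)"
  define G where "G = (\<lambda>(k, l). a (k, l) * z ^ k * w ^ l)"
  have "(F has_sum \<phi> (z, w)) UNIV" "(G has_sum f (z, w)) UNIV"
    using assms zw unfolding F_def G_def power_series2_def by auto
  then have "((\<lambda>(x, y). F x * G y) has_sum (\<phi> (z, w) * f (z, w))) (UNIV \<times> UNIV)"
    by (rule has_sum_product_abs)
  also have "?this \<longleftrightarrow> ((\<lambda>((k, l), (i, j)). F (i, j) * G (k - i, l - j)) has_sum (\<phi> (z, w) * f (z, w)))
      (Sigma UNIV (\<lambda>(k, l). {..k} \<times> {..l}))"
    by (rule has_sum_reindex_bij_witness[where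
        j = "\<lambda>((i, j), (p, q)). ((i + p, j + q), (i, j))" and
        i = "\<lambda>((k, l), (i, j)). ((i, j), (k - i, l - j))"]) auto
  finally have "((\<lambda>((k, l), (i, j)). F (i, j) * G (k - i, l - j)) has_sum (\<phi> (z, w) * f (z, w)))
      (Sigma UNIV (\<lambda>(k, l). {..k} \<times> {..l}))" .
  then show "((\<lambda>(k, l). convolution2 c a (k, l) * z ^ k * w ^ l) has_sum \<phi> (z, w) * f (z, w)) UNIV"
  proof (rule has_sum_SigmaD, goal_cases)
    case (1 x)
    obtain k l where x: "x = (k, l)" by force
    have tm: "F (i, j) * G (k - i, l - j) = c (i, j) * a (k - i, l - j) * z ^ k * w ^ l" if "i \<le> k" "j \<le> l" for i j
    proof -
      have "z ^ k = z ^ i * z ^ (k - i)" "w ^ l = w ^ j * w ^ (l - j)"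
        using that by (simp_all flip: power_add)
      then show ?thesis by (simp add: F_def G_def)
    qed
    have "(\<Sum>(i, j)\<in>{..k} \<times> {..l}. F (i, j) * G (k - i, l - j)) = (\<Sum>i\<le>k. \<Sum>j\<le>l. F (i, j) * G (k - i, l - j))"
      by (rule sum.cartesian_product[symmetric])
    also have "\<dots> = (\<Sum>i\<le>k. \<Sum>j\<le>l. c (i, j) * a (k - i, l - j) * z ^ k * w ^ l)"
      by (intro sum.cong refl tm) auto
    also have "\<dots> = convolution2 c a (k, l) * z ^ k * w ^ l"
      by (simp add: convolution2_def sum_distrib_right)
    finally show ?case
      unfolding x by (intro has_sum_finiteI) (simp_all add: case_prod_unfold)
  qed
qed

text \<open>
  Convolution is lower triangular: cutting \<open>a\<close> off outside the rectangle does not change the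
  convolution inside it, and turns the second factor into a polynomial.
\<close>

lemma bounded_multiplier_coeffs_le:
  assumes \<phi>: "power_series2 c \<phi>"
    and bd: "\<And>p. p \<in> bidisc \<Longrightarrow> cmod (\<phi> p) \<le> C"
  shows "(\<Sum>k\<le>N. \<Sum>l\<le>M. (cmod (convolution2 c a (k, l)))\<^sup>2) \<le> C\<^sup>2 * (\<Sum>k\<le>N. \<Sum>l\<le>M. (cmod (a (k, l)))\<^sup>2)"
proof -
  define a' where "a' = (\<lambda>(k, l). if k \<le> N \<and> l \<le> M then a (k, l) else 0)"
  define h where "h = (\<lambda>(z, w). \<Sum>k\<le>N. \<Sum>l\<le>M. a (k, l) * z ^ k * w ^ l)"
  have h: "power_series2 a' h"
    unfolding power_series2_def
  proof safe
    fix z w :: complex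
    have "((\<lambda>(k, l). a' (k, l) * z ^ k * w ^ l) has_sum (\<Sum>(k, l)\<in>{..N} \<times> {..M}. a' (k, l) * z ^ k * w ^ l)) UNIV"
      by (rule has_sum_finite_neutralI) (auto simp: a'_def split: if_splits)
    also have "(\<Sum>(k, l)\<in>{..N} \<times> {..M}. a' (k, l) * z ^ k * w ^ l) = h (z, w)"
      unfolding sum.cartesian_product[symmetric] h_def by (auto simp: a'_def intro!: sum.cong)
    finally show "((\<lambda>(k, l). a' (k, l) * z ^ k * w ^ l) has_sum h (z, w)) UNIV" .
  qed
  have "0 \<le> C" using order.trans[OF norm_ge_zero bd[of "(0, 0)"]] by (simp add: bidisc_def)
  then have "(\<Sum>k\<le>N. \<Sum>l\<le>M. (cmod (convolution2 c a' (k, l)))\<^sup>2) \<le> C\<^sup>2 * (\<Sum>k\<le>N. \<Sum>l\<le>M. (cmod (a (k, l)))\<^sup>2)"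
  proof (rule dominated_by_polynomial_imp_coeffs_le[OF power_series2_mult[OF \<phi> h], rotated])
    fix z w :: complex assume "cmod z < 1" "cmod w < 1"
    then show "cmod (\<phi> (z, w) * h (z, w)) \<le> C * cmod (\<Sum>k\<le>N. \<Sum>l\<le>M. a (k, l) * z ^ k * w ^ l)"
      using bd[of "(z, w)"] by (auto simp: h_def norm_mult bidisc_def intro!: mult_right_mono)
  qed
  moreover have "convolution2 c a' (k, l) = convolution2 c a (k, l)" if "k \<le> N" "l \<le> M" for k l
    unfolding convolution2_def using that by (auto simp: a'_def intro!: sum.cong)
  ultimately show ?thesis by simp
qed

section \<open>Abel summation against decreasing weights\<close>

text \<open>
  The induction carries the stronger statement that the difference of the two weighted sums is at
  least \<open>u n\<close> times the difference of the plain sums.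
\<close>

lemma weighted_sum_mono:
  fixes A B u :: "nat \<Rightarrow> real"
  assumes u0: "\<And>n. u n \<ge> 0" and u: "\<And>n. u (Suc n) \<le> u n"
    and le: "\<And>n. (\<Sum>k\<le>n. B k) \<le> (\<Sum>k\<le>n. A k)"
  shows "(\<Sum>k\<le>n. u k * B k) \<le> (\<Sum>k\<le>n. u k * A k)"
proof -
  have "u n * ((\<Sum>k\<le>n. A k) - (\<Sum>k\<le>n. B k)) \<le> (\<Sum>k\<le>n. u k * A k) - (\<Sum>k\<le>n. u k * B k)" for n
  proof (induction n)
    case (Suc n)
    have "u (Suc n) * ((\<Sum>k\<le>n. A k) - (\<Sum>k\<le>n. B k)) \<le> u n * ((\<Sum>k\<le>n. A k) - (\<Sum>k\<le>n. B k))"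
      using le[of n] u[of n] by (intro mult_right_mono) auto
    then show ?case using Suc.IH by (simp add: algebra_simps)
  qed (simp add: algebra_simps)
  from this[of n] show ?thesis
    using mult_nonneg_nonneg[OF u0[of n], of "(\<Sum>k\<le>n. A k) - (\<Sum>k\<le>n. B k)"] le[of n] by linarith
qed

lemma weighted_sum_mono2:
  fixes A B :: "nat \<Rightarrow> nat \<Rightarrow> real" and u v :: "nat \<Rightarrow> real"
  assumes u0: "\<And>n. u n \<ge> 0" and u: "\<And>n. u (Suc n) \<le> u n"
    and v0: "\<And>n. v n \<ge> 0" and v: "\<And>n. v (Suc n) \<le> v n"
    and le: "\<And>n m. (\<Sum>k\<le>n. \<Sum>l\<le>m. B k l) \<le> (\<Sum>k\<le>n. \<Sum>l\<le>m. A k l)"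
  shows "(\<Sum>k\<le>n. \<Sum>l\<le>m. B k l * u k * v l) \<le> (\<Sum>k\<le>n. \<Sum>l\<le>m. A k l * u k * v l)"
proof -
  have "(\<Sum>k\<le>n. u k * (\<Sum>l\<le>m. B k l)) \<le> (\<Sum>k\<le>n. u k * (\<Sum>l\<le>m. A k l))" for m
    by (rule weighted_sum_mono[of u "\<lambda>k. \<Sum>l\<le>m. B k l" "\<lambda>k. \<Sum>l\<le>m. A k l", OF u0 u le])
  then have "(\<Sum>l\<le>m. \<Sum>k\<le>n. u k * B k l) \<le> (\<Sum>l\<le>m. \<Sum>k\<le>n. u k * A k l)" for m
    by (subst (1 2) sum.swap) (simp add: sum_distrib_left)
  then have "(\<Sum>l\<le>m. v l * (\<Sum>k\<le>n. u k * B k l)) \<le> (\<Sum>l\<le>m. v l * (\<Sum>k\<le>n. u k * A k l))"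
    by (rule weighted_sum_mono[of v, OF v0 v])
  then show ?thesis
    by (subst (1 2) sum.swap) (simp add: sum_distrib_left mult_ac)
qed

section \<open>Power series are holomorphic\<close>

text \<open>
  From \<open>R\<^sup>k - r\<^sup>k = (R - r) \<Sum> R\<^sup>i r\<^sup>k\<^sup>-\<^sup>1\<^sup>-\<^sup>i\<close>. It lets absolute convergence at radius \<open>R\<close> control the
  differentiated series at radius \<open>r\<close>, with no polynomial factors left over.
\<close>

lemma power_pred_le:
  fixes r R :: real
  assumes "0 \<le> r" "r < R"
  shows "real k * r ^ (k - 1) \<le> R ^ k / (R - r)"
proof (cases k)
  case (Suc n)
  have "real (Suc n) * r ^ n = (\<Sum>i<Suc n. r ^ i * r ^ (n - i))"
    by (subst sum.cong[OF refl, of _ _ "\<lambda>_. r ^ n"]) (auto simp flip: power_add)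
  also have "\<dots> \<le> (\<Sum>i<Suc n. R ^ i * r ^ (n - i))"
    using assms by (intro sum_mono mult_right_mono power_mono) auto
  finally have "(R - r) * (real (Suc n) * r ^ n) \<le> (R - r) * (\<Sum>i<Suc n. R ^ i * r ^ (n - i))"
    using assms by (intro mult_left_mono) auto
  also have "\<dots> = R ^ Suc n - r ^ Suc n"
    using diff_power_eq_sum[of R n r] by (simp add: mult.commute)
  also have "\<dots> \<le> R ^ Suc n" using assms by simp
  finally show ?thesis using assms Suc by (simp add: field_simps)
qed (use assms in simp)

text \<open>
  Enumerate the terms as a single series and differentiate it term by term near each point: on
  a bidisc of radius \<open>r < R < 1\<close> both series of partial derivatives are dominated by one summable
  sequence \<open>c\<close>.
\<close>

lemma power_series2_imp_holomorphic2:
  assumes f: "power_series2 a f"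
  shows "f holomorphic2_on bidisc"
  unfolding holomorphic2_on_def
proof
  fix p0 :: "complex \<times> complex" assume "p0 \<in> bidisc"
  then have "max (cmod (fst p0)) (cmod (snd p0)) < 1" by (auto simp: bidisc_def)
  then obtain r where r: "max (cmod (fst p0)) (cmod (snd p0)) < r" "r < 1" using dense by blast
  then obtain R where R: "r < R" "R < 1" using dense by blast
  have r0: "0 < r" using r(1) norm_ge_zero[of "fst p0"] by linarith
  define S :: "(complex \<times> complex) set" where "S = ball 0 r \<times> ball 0 r"
  have S: "open S" "convex S" "p0 \<in> S"
    using r by (auto simp: S_def open_Times convex_Times mem_Times_iff)
  define A where "A n = a (prod_decode n)" for n
  define k where "k n = fst (prod_decode n)" for n
  define l where "l n = snd (prod_decode n)" for n
  define T where "T n p = A n * fst p ^ k n * snd p ^ l n" for n p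
  define P where "P n p = A n * (of_nat (k n) * fst p ^ (k n - 1)) * snd p ^ l n" for n p
  define Q where "Q n p = A n * fst p ^ k n * (of_nat (l n) * snd p ^ (l n - 1))" for n p
  define c where "c n = cmod (A n) * R ^ k n * R ^ l n / (R - r)" for n
  have "(\<lambda>(i, j). cmod (a (i, j)) * R ^ i * R ^ j) summable_on UNIV"
    by (rule power_series2_abs_summable[OF f]) (use r0 R in auto)
  then have "(\<lambda>n. case prod_decode n of (i, j) \<Rightarrow> cmod (a (i, j)) * R ^ i * R ^ j) summable_on UNIV"
    by (subst summable_on_reindex_bij_betw[OF bij_prod_decode])
  then have "summable (\<lambda>n. cmod (A n) * R ^ k n * R ^ l n)"
    by (intro summable_on_imp_summable) (simp add: A_def k_def l_def case_prod_unfold)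
  then have c: "summable c" unfolding c_def by (rule summable_divide)
  have P_le: "cmod (P n p) \<le> c n" and Q_le: "cmod (Q n p) \<le> c n" if "p \<in> S" for n p
  proof -
    obtain z w where p: "p = (z, w)" by force
    have zw: "cmod z \<le> r" "cmod w \<le> r" using that by (auto simp: S_def p)
    have deriv_le: "real i * x ^ (i - 1) \<le> R ^ i / (R - r)" if "0 \<le> x" "x \<le> r" for x i
      by (rule order.trans[OF mult_left_mono[OF power_mono[OF that(2,1)]] power_pred_le]) (use r0 R in auto)
    have pow_le: "x ^ i \<le> R ^ i" if "0 \<le> x" "x \<le> r" for x i
      by (rule power_mono) (use that R in auto)
    have "cmod (P n p) = cmod (A n) * ((real (k n) * cmod z ^ (k n - 1)) * cmod w ^ l n)"
      by (simp add: P_def p norm_mult norm_power)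
    also have "\<dots> \<le> cmod (A n) * (R ^ k n / (R - r) * R ^ l n)"
      using zw r0 R by (intro mult_left_mono mult_mono deriv_le pow_le) auto
    finally show "cmod (P n p) \<le> c n" by (simp add: c_def mult_ac)
    have "cmod (Q n p) = cmod (A n) * (cmod z ^ k n * (real (l n) * cmod w ^ (l n - 1)))"
      by (simp add: Q_def p norm_mult norm_power)
    also have "\<dots> \<le> cmod (A n) * (R ^ k n * (R ^ l n / (R - r)))"
      using zw r0 R by (intro mult_left_mono mult_mono deriv_le pow_le) auto
    finally show "cmod (Q n p) \<le> c n" by (simp add: c_def mult_ac)
  qed
  have tail: "cmod ((\<Sum>i<n. H i) - suminf H) \<le> (\<Sum>i. c (i + n))" if "\<And>i. cmod (H i) \<le> c i" for H n
  proof -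
    have H: "summable H" by (rule summable_comparison_test'[OF c]) (use that in auto)
    have "cmod ((\<Sum>i<n. H i) - suminf H) = cmod (\<Sum>i. H (i + n))"
      using suminf_split_initial_segment[OF H, of n] by (simp add: norm_minus_commute)
    also have "\<dots> \<le> (\<Sum>i. c (i + n))"
      by (rule norm_suminf_le) (use that c in \<open>auto simp: summable_iff_shift\<close>)
    finally show ?thesis .
  qed
  have sums: "(\<lambda>n. T n p) sums f p" if "p \<in> S" for p
  proof -
    have "((\<lambda>(i, j). a (i, j) * fst p ^ i * snd p ^ j) has_sum f (fst p, snd p)) UNIV"
      by (rule power_series2D[OF f]) (use that r in \<open>auto simp: S_def\<close>)
    then have "((\<lambda>n. case prod_decode n of (i, j) \<Rightarrow> a (i, j) * fst p ^ i * snd p ^ j) has_sum f (fst p, snd p)) UNIV"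
      by (subst has_sum_reindex_bij_betw[OF bij_prod_decode])
    then show ?thesis
      by (intro has_sum_imp_sums) (simp add: T_def A_def k_def l_def case_prod_unfold)
  qed
  have "\<exists>g. \<forall>p\<in>S. (\<lambda>n. T n p) sums g p \<and>
      (g has_derivative (\<lambda>h. (\<Sum>n. P n p) * fst h + (\<Sum>n. Q n p) * snd h)) (at p within S)"
  proof (rule has_derivative_series[where f = T and f' = "\<lambda>n p h. P n p * fst h + Q n p * snd h"
        and g' = "\<lambda>p h. (\<Sum>n. P n p) * fst h + (\<Sum>n. Q n p) * snd h", OF S(2) _ _ S(3) sums[OF S(3)]])
    show "(T n has_derivative (\<lambda>h. P n p * fst h + Q n p * snd h)) (at p within S)" for n p
      unfolding T_def P_def Q_def
      by (auto intro!: derivative_eq_intros simp: algebra_simps)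
  next
    fix e :: real assume e: "e > 0"
    obtain N where N: "\<And>n. n \<ge> N \<Longrightarrow> norm (\<Sum>i. c (i + n)) < e / 2"
      using suminf_exist_split[OF half_gt_zero[OF e] c] by blast
    show "\<forall>\<^sub>F n in sequentially. \<forall>p\<in>S. \<forall>h. norm ((\<Sum>i<n. P i p * fst h + Q i p * snd h) -
        ((\<Sum>n. P n p) * fst h + (\<Sum>n. Q n p) * snd h)) \<le> e * norm h"
      unfolding eventually_sequentially
    proof (intro exI[of _ N] allI impI ballI)
      fix n p and h :: "complex \<times> complex" assume n: "N \<le> n" and p: "p \<in> S"
      have small: "(\<Sum>i. c (i + n)) \<le> e / 2" using N[OF n] by simp
      have "(\<Sum>i<n. P i p * fst h + Q i p * snd h) - ((\<Sum>n. P n p) * fst h + (\<Sum>n. Q n p) * snd h)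
          = ((\<Sum>i<n. P i p) - (\<Sum>n. P n p)) * fst h + ((\<Sum>i<n. Q i p) - (\<Sum>n. Q n p)) * snd h"
        by (simp only: sum.distrib sum_distrib_right[symmetric]) (simp add: algebra_simps)
      also have "cmod \<dots> \<le> e / 2 * norm h + e / 2 * norm h"
        unfolding norm_mult[symmetric]
        by (rule order.trans[OF norm_triangle_ineq], unfold norm_mult, intro add_mono mult_mono
            order.trans[OF tail small] P_le Q_le p norm_fst_le[of "fst h" "snd h", simplified]
            norm_snd_le[of "snd h" "fst h", simplified]) (use e in auto)
      finally show "norm ((\<Sum>i<n. P i p * fst h + Q i p * snd h) -
          ((\<Sum>n. P n p) * fst h + (\<Sum>n. Q n p) * snd h)) \<le> e * norm h" by simp
    qed
  qed
  then obtain g where g: "\<And>p. p \<in> S \<Longrightarrow> (\<lambda>n. T n p) sums g p"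
    "\<And>p. p \<in> S \<Longrightarrow> (g has_derivative (\<lambda>h. (\<Sum>n. P n p) * fst h + (\<Sum>n. Q n p) * snd h)) (at p within S)"
    by blast
  have "(g has_derivative (\<lambda>h. (\<Sum>n. P n p0) * fst h + (\<Sum>n. Q n p0) * snd h)) (at p0)"
    using g(2)[OF S(3)] at_within_open[OF S(3,1)] by simp
  then have "(f has_derivative (\<lambda>h. (\<Sum>n. P n p0) * fst h + (\<Sum>n. Q n p0) * snd h)) (at p0)"
    by (rule has_derivative_transform_within_open[OF _ S(1,3)]) (use g(1) sums sums_unique2 in blast)
  then show "\<exists>c d. (f has_derivative (\<lambda>(h, k). c * h + d * k)) (at p0)"
    unfolding case_prod_unfold by blast
qed

section \<open>Bounded holomorphic functions have power series\<close>

definition taylor_coeff :: "(complex \<Rightarrow> complex) \<Rightarrow> nat \<Rightarrow> complex" where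
  "taylor_coeff g k = (deriv ^^ k) g 0 / fact k"

text \<open>
  Cauchy's inequality on the circle of radius \<open>r\<close> bounds the coefficient by \<open>C / r\<^sup>k\<close>; let \<open>r\<close> tend to 1.
\<close>

lemma taylor_coeff_bounded:
  assumes hol: "g holomorphic_on ball 0 1" and le: "\<And>z. cmod z < 1 \<Longrightarrow> cmod (g z) \<le> C"
  shows "cmod (taylor_coeff g k) \<le> C"
proof -
  have "cmod (taylor_coeff g k) * r ^ k \<le> C" if r: "0 < r" "r < 1" for r
  proof -
    have "cmod ((deriv ^^ k) g 0) \<le> fact k * C / r ^ k"
    proof (rule Cauchy_inequality)
      show "g holomorphic_on ball 0 r" by (rule holomorphic_on_subset[OF hol]) (use r in auto)
      show "continuous_on (cball 0 r) g"
        by (rule continuous_on_subset[OF holomorphic_on_imp_continuous_on[OF hol]]) (use r in auto)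
    qed (use r le in auto)
    then show ?thesis using r by (simp add: taylor_coeff_def norm_divide field_simps)
  qed
  then have "\<forall>\<^sub>F r in at_left 1. cmod (taylor_coeff g k) * r ^ k \<le> C"
    by (auto simp: eventually_at_left_field intro!: exI[of _ 0])
  moreover have "((\<lambda>r::real. cmod (taylor_coeff g k) * r ^ k) \<longlongrightarrow> cmod (taylor_coeff g k) * 1 ^ k) (at_left 1)"
    by (intro tendsto_intros)
  ultimately show ?thesis
    using tendsto_upperbound[of "\<lambda>r. cmod (taylor_coeff g k) * r ^ k" _ "at_left 1"] by simp
qed

lemma taylor_coeff_has_sum:
  assumes hol: "g holomorphic_on ball 0 1" and le: "\<And>z. cmod z < 1 \<Longrightarrow> cmod (g z) \<le> C"
    and z: "cmod z < 1"
  shows "((\<lambda>k. taylor_coeff g k * z ^ k) has_sum g z) UNIV"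
proof (rule norm_summable_imp_has_sum)
  show "summable (\<lambda>k. norm (taylor_coeff g k * z ^ k))"
    by (rule summable_comparison_test'[OF summable_mult[OF summable_geometric[of "cmod z"], of C]])
       (use z taylor_coeff_bounded[OF hol le] in \<open>auto simp: norm_mult norm_power intro!: mult_right_mono\<close>)
  show "(\<lambda>k. taylor_coeff g k * z ^ k) sums g z"
    using holomorphic_power_series[OF hol, of z] z by (simp add: taylor_coeff_def)
qed

text \<open>
  The rate of convergence depends on \<open>g\<close> only through its bound \<open>C\<close>. This uniformity makes the
  coefficients of a holomorphic family uniform limits of holomorphic functions of the parameter.
\<close>

lemma taylor_coeff_approx:
  assumes hol: "g holomorphic_on ball 0 1" and le: "\<And>z. cmod z < 1 \<Longrightarrow> cmod (g z) \<le> C"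
    and z: "z \<noteq> 0" "cmod z \<le> 1/2"
  shows "cmod ((g z - (\<Sum>j<k. taylor_coeff g j * z ^ j)) / z ^ k - taylor_coeff g k) \<le> 2 * C * cmod z"
proof -
  have z1: "cmod z < 1" using z by simp
  have C0: "0 \<le> C" using order.trans[OF norm_ge_zero le[of 0]] by simp
  let ?t = "\<lambda>j. taylor_coeff g j * z ^ j"
  have s: "?t sums g z" by (rule has_sum_imp_sums[OF taylor_coeff_has_sum[OF hol le z1]])
  have geo: "(\<lambda>j. C * cmod z ^ Suc k * cmod z ^ j) sums (C * cmod z ^ Suc k * (1 / (1 - cmod z)))"
    by (intro sums_mult geometric_sums) (use z1 in simp)
  have "g z = (\<Sum>j. ?t (j + Suc k)) + (\<Sum>j<Suc k. ?t j)"
    by (rule trans[OF sums_unique[OF s] suminf_split_initial_segment[OF sums_summable[OF s]]])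
  then have eq: "(g z - (\<Sum>j<k. ?t j)) / z ^ k - taylor_coeff g k = (\<Sum>j. ?t (j + Suc k)) / z ^ k"
    using z(1) by (simp add: field_simps)
  have "cmod (\<Sum>j. ?t (j + Suc k)) \<le> (\<Sum>j. C * cmod z ^ Suc k * cmod z ^ j)"
  proof (rule norm_suminf_le[OF _ sums_summable[OF geo]])
    fix j
    have "cmod (?t (j + Suc k)) = cmod (taylor_coeff g (j + Suc k)) * (cmod z ^ Suc k * cmod z ^ j)"
      by (simp add: norm_mult norm_power power_add mult_ac)
    also have "\<dots> \<le> C * (cmod z ^ Suc k * cmod z ^ j)"
      by (intro mult_right_mono taylor_coeff_bounded[OF hol le]) auto
    finally show "cmod (?t (j + Suc k)) \<le> C * cmod z ^ Suc k * cmod z ^ j" by (simp add: mult.assoc)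
  qed
  also have "\<dots> = C * cmod z ^ Suc k * (1 / (1 - cmod z))"
    using sums_unique[OF geo] by simp
  also have "\<dots> \<le> C * cmod z ^ Suc k * 2"
    using C0 z by (intro mult_left_mono) (auto simp: field_simps)
  finally have "cmod (\<Sum>j. ?t (j + Suc k)) / cmod z ^ k \<le> C * cmod z ^ Suc k * 2 / cmod z ^ k"
    by (intro divide_right_mono) auto
  also have "\<dots> = 2 * C * cmod z" using z(1) by simp
  finally show ?thesis unfolding eq by (simp add: norm_divide norm_power)
qed

lemma holomorphic2_imp_separately_holomorphic:
  assumes "f holomorphic2_on bidisc"
  shows "cmod w < 1 \<Longrightarrow> (\<lambda>z. f (z, w)) holomorphic_on ball 0 1"
    and "cmod z < 1 \<Longrightarrow> (\<lambda>w. f (z, w)) holomorphic_on ball 0 1"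
proof -
  have partial: "((\<lambda>z. f (z, w)) has_field_derivative c) (at z)" "((\<lambda>w. f (z, w)) has_field_derivative d) (at w)"
    if D: "(f has_derivative (\<lambda>(h, k). c * h + d * k)) (at (z, w))" for z w c d
  proof -
    have "((\<lambda>z. (z, w)) has_derivative (\<lambda>h. (h, 0))) (at z)" "((\<lambda>w. (z, w)) has_derivative (\<lambda>h. (0, h))) (at w)"
      by (auto intro!: derivative_eq_intros)
    from this[THEN has_derivative_compose, OF D]
    show "((\<lambda>z. f (z, w)) has_field_derivative c) (at z)" "((\<lambda>w. f (z, w)) has_field_derivative d) (at w)"
      by (simp_all add: has_field_derivative_def)
  qed
  have ex: "\<exists>c d. (f has_derivative (\<lambda>(h, k). c * h + d * k)) (at (z, w))" if "cmod z < 1" "cmod w < 1" for z w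
    using assms that by (auto simp: holomorphic2_on_def bidisc_def)
  show "(\<lambda>z. f (z, w)) holomorphic_on ball 0 1" if "cmod w < 1"
    unfolding holomorphic_on_open[OF open_ball] using ex[OF _ that] partial(1) by fastforce
  show "(\<lambda>w. f (z, w)) holomorphic_on ball 0 1" if "cmod z < 1"
    unfolding holomorphic_on_open[OF open_ball] using ex[OF that] partial(2) by fastforce
qed

text \<open>
  Once the coefficients of index below \<open>k\<close> are known to be holomorphic in \<open>w\<close>, the \<open>k\<close>-th one is
  the uniform limit as \<open>z\<close> tends to 0 of \<open>(f(z, w) - \<Sum>\<^sub>j\<^sub><\<^sub>k A\<^sub>j(w) z\<^sup>j) / z\<^sup>k\<close>, which is
  holomorphic in \<open>w\<close> for each \<open>z\<close>.
\<close>

lemma partial_taylor_coeff_holomorphic: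
  assumes f1: "\<And>w. cmod w < 1 \<Longrightarrow> (\<lambda>z. f (z, w)) holomorphic_on ball 0 1"
    and f2: "\<And>z. cmod z < 1 \<Longrightarrow> (\<lambda>w. f (z, w)) holomorphic_on ball 0 1"
    and le: "\<And>z w. cmod z < 1 \<Longrightarrow> cmod w < 1 \<Longrightarrow> cmod (f (z, w)) \<le> C"
  shows "(\<lambda>w. taylor_coeff (\<lambda>z. f (z, w)) k) holomorphic_on ball 0 1"
proof (induction k rule: less_induct)
  case (less k)
  let ?A = "\<lambda>j w. taylor_coeff (\<lambda>z. f (z, w)) j"
  \<comment> \<open>Any null sequence of nonzero points with modulus at most \<open>1/2\<close> would do.\<close>
  define \<zeta> :: "nat \<Rightarrow> complex" where "\<zeta> n = of_real (1 / real (n + 2))" for n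
  have norm_\<zeta>: "cmod (\<zeta> n) = 1 / real (n + 2)" for n
    unfolding \<zeta>_def by (simp only: norm_of_real) simp
  have \<zeta>: "\<zeta> n \<noteq> 0" "cmod (\<zeta> n) \<le> 1/2" for n
  proof -
    show "\<zeta> n \<noteq> 0" using norm_\<zeta>[of n] by auto
    show "cmod (\<zeta> n) \<le> 1/2" unfolding norm_\<zeta> by (simp add: field_simps)
  qed
  define F where "F n w = (f (\<zeta> n, w) - (\<Sum>j<k. ?A j w * \<zeta> n ^ j)) / \<zeta> n ^ k" for n w
  show ?case
  proof (rule holomorphic_uniform_sequence[OF open_ball])
    show "F n holomorphic_on ball 0 1" for n
      unfolding F_def using \<zeta>[of n]
      by (intro holomorphic_intros f2 less.IH) auto
  next
    fix w :: complex assume "w \<in> ball 0 1"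
    then obtain d where d: "d > 0" "cball w d \<subseteq> ball 0 1"
      using open_contains_cball[of "ball (0::complex) 1"] open_ball by blast
    have "uniform_limit (cball w d) F (?A k) sequentially"
    proof (rule uniform_limitI)
      fix e :: real assume e: "e > 0"
      have "(\<lambda>n. 2 * C * (1 / real (n + 2))) \<longlonglongrightarrow> 0" by real_asymp
      then have "\<forall>\<^sub>F n in sequentially. 2 * C * (1 / real (n + 2)) < e"
        using e by (rule order_tendstoD)
      then show "\<forall>\<^sub>F n in sequentially. \<forall>x\<in>cball w d. dist (F n x) (?A k x) < e"
      proof eventually_elim
        case (elim n)
        show ?case
        proof
          fix x assume "x \<in> cball w d"
          then have x: "cmod x < 1" using d by auto
          have "dist (F n x) (?A k x) \<le> 2 * C * cmod (\<zeta> n)"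
            unfolding F_def dist_norm
            by (rule taylor_coeff_approx[OF f1[OF x] le[OF _ x] \<zeta>])
          then show "dist (F n x) (?A k x) < e" using elim norm_\<zeta>[of n] by simp
        qed
      qed
    qed
    then show "\<exists>d>0. cball w d \<subseteq> ball 0 1 \<and> uniform_limit (cball w d) F (?A k) sequentially"
      using d by blast
  qed
qed

text \<open>
  Expand in \<open>z\<close>, then expand each coefficient in \<open>w\<close>. Every coefficient met on the way is bounded by
  \<open>C\<close>, so the double series is dominated by a product of geometric series.
\<close>

lemma bounded_holomorphic2_imp_power_series2:
  assumes hol: "f holomorphic2_on bidisc" and bd: "\<And>p. p \<in> bidisc \<Longrightarrow> cmod (f p) \<le> C"
  shows "\<exists>a. power_series2 a f"
proof -
  note f1 = holomorphic2_imp_separately_holomorphic(1)[OF hol]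
  note f2 = holomorphic2_imp_separately_holomorphic(2)[OF hol]
  have le: "cmod (f (z, w)) \<le> C" if "cmod z < 1" "cmod w < 1" for z w
    using bd that by (auto simp: bidisc_def)
  define A where "A k w = taylor_coeff (\<lambda>z. f (z, w)) k" for k w
  have A_hol: "A k holomorphic_on ball 0 1" for k
    unfolding A_def by (rule partial_taylor_coeff_holomorphic[OF f1 f2 le])
  have A_le: "cmod (A k w) \<le> C" if "cmod w < 1" for k w
    unfolding A_def by (rule taylor_coeff_bounded[OF f1[OF that] le[OF _ that]])
  define a where "a = (\<lambda>(k, l). taylor_coeff (A k) l)"
  have a_le: "cmod (a p) \<le> C" for p
    unfolding a_def by (cases p) (simp add: taylor_coeff_bounded[OF A_hol A_le])
  have "((\<lambda>(k, l). a (k, l) * z ^ k * w ^ l) has_sum f (z, w)) (UNIV \<times> UNIV)"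
    if z: "cmod z < 1" and w: "cmod w < 1" for z w
  proof (rule has_sum_SigmaI)
    show "((\<lambda>k. A k w * z ^ k) has_sum f (z, w)) UNIV"
      unfolding A_def by (rule taylor_coeff_has_sum[OF f1[OF w] le[OF _ w] z])
    show "((\<lambda>l. case (k, l) of (k, l) \<Rightarrow> a (k, l) * z ^ k * w ^ l) has_sum A k w * z ^ k) UNIV" for k
      using has_sum_cmult_left[OF taylor_coeff_has_sum[OF A_hol A_le w], of k "z ^ k"]
      by (simp add: a_def mult_ac)
    have geo: "((\<lambda>n. x ^ n) has_sum (1 / (1 - x))) UNIV" if "0 \<le> x" "x < 1" for x :: real
      by (rule sums_nonneg_imp_has_sum[OF geometric_sums]) (use that in auto)
    have "(\<lambda>(k, l). C * cmod z ^ k * cmod w ^ l) summable_on UNIV \<times> UNIV"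
    proof (rule summable_on_SigmaI)
      show "((\<lambda>l. case (k, l) of (k, l) \<Rightarrow> C * cmod z ^ k * cmod w ^ l) has_sum C * cmod z ^ k * (1 / (1 - cmod w))) UNIV" for k
        using has_sum_cmult_right[OF geo[of "cmod w"]] w by simp
      show "(\<lambda>k. C * cmod z ^ k * (1 / (1 - cmod w))) summable_on UNIV"
        by (intro summable_on_cmult_left summable_on_cmult_right has_sum_imp_summable[OF geo]) (use z in auto)
    qed (use le[of 0 0] in \<open>auto intro!: mult_nonneg_nonneg intro: order.trans[OF norm_ge_zero]\<close>)
    then have "(\<lambda>p. norm (case p of (k, l) \<Rightarrow> a (k, l) * z ^ k * w ^ l)) summable_on UNIV \<times> UNIV"
      by (rule summable_on_comparison_test)
         (auto simp: norm_mult norm_power intro!: mult_right_mono a_le)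
    then show "(\<lambda>(k, l). a (k, l) * z ^ k * w ^ l) summable_on UNIV \<times> UNIV"
      by (rule abs_summable_summable)
  qed
  then have "power_series2 a f" unfolding power_series2_def bidisc_def by auto
  then show ?thesis by blast
qed

section \<open>The spaces and their multipliers\<close>

definition Dweight :: "real \<times> real \<Rightarrow> nat \<times> nat \<Rightarrow> real" where
  "Dweight \<alpha> = (\<lambda>(k, l). (real k + 1) powr fst \<alpha> * (real l + 1) powr snd \<alpha>)"

lemma Dweight_pos: "Dweight \<alpha> p > 0"
  by (cases p) (simp add: Dweight_def)

lemma Dspace_iff:
  "f \<in> Dspace \<alpha> \<longleftrightarrow> (\<exists>a. power_series2 a f \<and> (\<lambda>p. (cmod (a p))\<^sup>2 * Dweight \<alpha> p) summable_on UNIV)"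
  by (simp add: Dspace_def power_series2_def Dweight_def case_prod_unfold mult.assoc)

lemma multipliersD:
  "\<phi> \<in> multipliers \<alpha> \<Longrightarrow> f \<in> Dspace \<alpha> \<Longrightarrow> (\<lambda>p. \<phi> p * f p) \<in> Dspace \<alpha>"
  by (simp add: multipliers_def)

lemma summable_power_div_powr:
  fixes r s :: real
  assumes "0 \<le> r" "r < 1"
  shows "(\<lambda>k. (r ^ k)\<^sup>2 / (real k + 1) powr s) summable_on UNIV"
proof -
  have r2: "0 \<le> r\<^sup>2" "r\<^sup>2 < 1" using assms by (auto simp: power_less_one_iff)
  obtain x where x: "r\<^sup>2 < x" "x < 1" using dense[OF r2(2)] by blast
  obtain y where y: "x < y" "y < 1" using dense[OF x(2)] by blast
  have x0: "0 < x" using r2 x by linarith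
  have "(\<lambda>k. x ^ k / (real k + 1) powr s) \<in> O(\<lambda>k. y ^ k)"
    using x0 y by real_asymp
  then have "summable (\<lambda>k. x ^ k / (real k + 1) powr s)"
    by (rule summable_comparison_test_bigo[rotated])
       (use x0 y in \<open>auto simp: norm_power intro!: summable_geometric\<close>)
  then have "(\<lambda>k. x ^ k / (real k + 1) powr s) summable_on UNIV"
    by (rule summable_nonneg_imp_summable_on) (use x0 in auto)
  then show ?thesis
  proof (rule summable_on_comparison_test)
    fix k
    have "(r ^ k)\<^sup>2 = (r\<^sup>2) ^ k" by (simp add: power_mult[symmetric] mult.commute)
    also have "\<dots> \<le> x ^ k" using x r2 by (intro power_mono) auto
    finally show "(r ^ k)\<^sup>2 / (real k + 1) powr s \<le> x ^ k / (real k + 1) powr s"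
      by (intro divide_right_mono) auto
  qed auto
qed

definition monomials :: "complex \<times> complex \<Rightarrow> nat \<times> nat \<Rightarrow> complex" where
  "monomials p = (\<lambda>(k, l). fst p ^ k * snd p ^ l)"

lemma power_series2_iff_monomials:
  "power_series2 a f \<longleftrightarrow> (\<forall>p\<in>bidisc. ((\<lambda>i. a i * monomials p i) has_sum f p) UNIV)"
  by (auto simp: power_series2_def monomials_def case_prod_unfold mult.assoc)

text \<open>
  The left-hand sum is the squared norm of the evaluation functional at \<open>p\<close>, a product of two
  one-variable sums.
\<close>

lemma monomials_square_summable:
  assumes "p \<in> bidisc"
  shows "(\<lambda>i. (cmod (monomials p i))\<^sup>2 / Dweight \<alpha> i) summable_on UNIV"
proof -
  obtain z w where p: "p = (z, w)" "cmod z < 1" "cmod w < 1" using assms by (auto simp: bidisc_def)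
  define F where "F k = (cmod z ^ k)\<^sup>2 / (real k + 1) powr fst \<alpha>" for k :: nat
  define G where "G l = (cmod w ^ l)\<^sup>2 / (real l + 1) powr snd \<alpha>" for l :: nat
  have F: "F summable_on UNIV" and G: "G summable_on UNIV"
    unfolding F_def G_def using p by (auto intro!: summable_power_div_powr)
  have "(\<lambda>(k, l). F k * G l) summable_on UNIV \<times> UNIV"
  proof (rule summable_on_SigmaI)
    show "((\<lambda>l. case (k, l) of (k, l) \<Rightarrow> F k * G l) has_sum F k * infsum G UNIV) UNIV" for k
      using G by (auto intro!: has_sum_cmult_right)
    show "(\<lambda>k. F k * infsum G UNIV) summable_on UNIV"
      by (rule summable_on_cmult_left[OF F])
  qed (auto simp: F_def G_def)
  then show ?thesis
    by (simp add: F_def G_def p monomials_def Dweight_def case_prod_unfold norm_mult norm_power power_mult_distrib)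
qed

lemma monomials_zero_index [simp]: "monomials p (0, 0) = 1"
  by (simp add: monomials_def)

lemma square_summable_imp_power_series2:
  assumes a: "(\<lambda>i. (cmod (a i))\<^sup>2 * Dweight \<alpha> i) summable_on UNIV"
  shows "power_series2 a (\<lambda>p. \<Sum>\<^sub>\<infinity>i. a i * monomials p i)"
  unfolding power_series2_iff_monomials
proof
  fix p assume p: "p \<in> bidisc"
  define K where "K = (\<Sum>\<^sub>\<infinity>i. (cmod (monomials p i))\<^sup>2 / Dweight \<alpha> i)"
  note sm = monomials_square_summable[OF p, of \<alpha>]
  have "0 < (cmod (monomials p (0, 0)))\<^sup>2 / Dweight \<alpha> (0, 0)" using Dweight_pos by simp
  also have "\<dots> \<le> K"
    unfolding K_def using finite_sum_le_infsum[OF sm, of "{(0, 0)}"] Dweight_pos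
    by (simp add: less_imp_le)
  finally have "0 < K" .
  then have "((\<lambda>i. (cmod (monomials p i))\<^sup>2 / Dweight \<alpha> i) has_sum (sqrt K)\<^sup>2) UNIV" "0 < sqrt K"
    using sm by (simp_all add: K_def)
  then have "(\<lambda>i. cmod (a i * monomials p i)) summable_on UNIV"
    by (rule weighted_pairing_bound(1)[where W = "Dweight \<alpha>" and a = a and x = "monomials p",
          OF Dweight_pos has_sum_infsum[OF a]])
  then show "((\<lambda>i. a i * monomials p i) has_sum (\<Sum>\<^sub>\<infinity>i. a i * monomials p i)) UNIV"
    by (rule has_sum_infsum[OF abs_summable_summable])
qed

text \<open>
  Applying the multiplier to the constant function 1 shows that it has a power series of its own.
\<close>

lemma multipliers_subset_Hinf: "multipliers \<alpha> \<subseteq> Hinf_bidisc"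
proof
  fix \<phi> assume \<phi>: "\<phi> \<in> multipliers \<alpha>"
  define \<delta> :: "nat \<times> nat \<Rightarrow> complex" where "\<delta> = (\<lambda>i. if i = (0, 0) then 1 else 0)"
  have "power_series2 \<delta> (\<lambda>_. 1)"
    unfolding power_series2_iff_monomials
    by (auto intro!: has_sum_finite_neutralI[where B = "{(0, 0)}"] simp: \<delta>_def split: if_splits)
  moreover have "(\<lambda>i. (cmod (\<delta> i))\<^sup>2 * Dweight \<alpha> i) summable_on UNIV"
    by (rule finite_nonzero_values_imp_summable_on, rule finite_subset[of _ "{(0, 0)}"])
       (auto simp: \<delta>_def split: if_splits)
  ultimately have "(\<lambda>_. 1) \<in> Dspace \<alpha>" unfolding Dspace_iff by blast
  then have "(\<lambda>p. \<phi> p * 1) \<in> Dspace \<alpha>" by (rule multipliersD[OF \<phi>])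
  then obtain c where "power_series2 c \<phi>" unfolding Dspace_iff by auto
  then have "\<phi> holomorphic2_on bidisc" by (rule power_series2_imp_holomorphic2)
  moreover have "bounded (\<phi> ` bidisc)"
  proof (rule multiplier_bounded[of "Dweight \<alpha>" bidisc monomials])
    show "\<exists>i. monomials p i \<noteq> 0" for p by (rule exI[of _ "(0, 0)"]) simp
    fix a assume a: "(\<lambda>i. (cmod (a i))\<^sup>2 * Dweight \<alpha> i) summable_on UNIV"
    then have "(\<lambda>p. \<Sum>\<^sub>\<infinity>i. a i * monomials p i) \<in> Dspace \<alpha>"
      unfolding Dspace_iff using square_summable_imp_power_series2 by blast
    then have "(\<lambda>p. \<phi> p * (\<Sum>\<^sub>\<infinity>i. a i * monomials p i)) \<in> Dspace \<alpha>"
      by (rule multipliersD[OF \<phi>])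
    then obtain b where b: "power_series2 b (\<lambda>p. \<phi> p * (\<Sum>\<^sub>\<infinity>i. a i * monomials p i))"
      "(\<lambda>i. (cmod (b i))\<^sup>2 * Dweight \<alpha> i) summable_on UNIV"
      unfolding Dspace_iff by blast
    have "\<phi> p * (\<Sum>\<^sub>\<infinity>i. a i * monomials p i) = (\<Sum>\<^sub>\<infinity>i. b i * monomials p i)" if "p \<in> bidisc" for p
      using b(1) that unfolding power_series2_iff_monomials by (intro infsumI[symmetric]) blast
    with b(2) show "\<exists>b. (\<lambda>i. (cmod (b i))\<^sup>2 * Dweight \<alpha> i) summable_on UNIV \<and>
        (\<forall>p\<in>bidisc. \<phi> p * (\<Sum>\<^sub>\<infinity>i. a i * monomials p i) = (\<Sum>\<^sub>\<infinity>i. b i * monomials p i))" by blast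
  qed (rule Dweight_pos monomials_square_summable; assumption)+
  ultimately show "\<phi> \<in> Hinf_bidisc" by (simp add: Hinf_bidisc_def)
qed

text \<open>
  For \<open>\<alpha> \<le> (0, 0)\<close> both factors of the weight decrease, so the coefficient inequality over
  rectangles carries over to the weighted sums.
\<close>

lemma Hinf_subset_multipliers:
  assumes \<alpha>: "\<alpha> \<le> (0, 0)"
  shows "Hinf_bidisc \<subseteq> multipliers \<alpha>"
proof
  fix \<phi> assume \<phi>: "\<phi> \<in> Hinf_bidisc"
  then obtain C where C: "\<And>p. p \<in> bidisc \<Longrightarrow> cmod (\<phi> p) \<le> C"
    unfolding Hinf_bidisc_def bounded_iff by auto
  obtain c where c: "power_series2 c \<phi>"
    using bounded_holomorphic2_imp_power_series2[of \<phi>, OF _ C] \<phi> unfolding Hinf_bidisc_def by blast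
  have decr: "(real (Suc n) + 1) powr s \<le> (real n + 1) powr s" if "s \<le> 0" for n s
    by (rule powr_mono2') (use that in auto)
  show "\<phi> \<in> multipliers \<alpha>"
    unfolding multipliers_def
  proof safe
    fix f assume "f \<in> Dspace \<alpha>"
    then obtain a where a: "power_series2 a f" "(\<lambda>p. (cmod (a p))\<^sup>2 * Dweight \<alpha> p) summable_on UNIV"
      unfolding Dspace_iff by blast
    let ?b = "convolution2 c a"
    define A where "A = (\<Sum>\<^sub>\<infinity>p. (cmod (a p))\<^sup>2 * Dweight \<alpha> p)"
    have rect: "(\<Sum>(k, l)\<in>{..n} \<times> {..m}. (cmod (?b (k, l)))\<^sup>2 * Dweight \<alpha> (k, l)) \<le> C\<^sup>2 * A" for n m
    proof -
      have "(\<Sum>(k, l)\<in>{..n} \<times> {..m}. (cmod (?b (k, l)))\<^sup>2 * Dweight \<alpha> (k, l))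
          = (\<Sum>k\<le>n. \<Sum>l\<le>m. (cmod (?b (k, l)))\<^sup>2 * (real k + 1) powr fst \<alpha> * (real l + 1) powr snd \<alpha>)"
        by (simp add: sum.cartesian_product Dweight_def mult.assoc)
      also have "\<dots> \<le> (\<Sum>k\<le>n. \<Sum>l\<le>m. (C\<^sup>2 * (cmod (a (k, l)))\<^sup>2) * (real k + 1) powr fst \<alpha> * (real l + 1) powr snd \<alpha>)"
        using \<alpha> bounded_multiplier_coeffs_le[OF c C]
        by (intro weighted_sum_mono2 decr) (auto simp: less_eq_prod_def sum_distrib_left)
      also have "\<dots> = C\<^sup>2 * (\<Sum>(k, l)\<in>{..n} \<times> {..m}. (cmod (a (k, l)))\<^sup>2 * Dweight \<alpha> (k, l))"
        by (simp add: sum.cartesian_product Dweight_def mult.assoc sum_distrib_left case_prod_unfold)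
      also have "\<dots> \<le> C\<^sup>2 * A"
        unfolding A_def using finite_sum_le_infsum[OF a(2), of "{..n} \<times> {..m}"] Dweight_pos
        by (intro mult_left_mono) (auto simp: case_prod_unfold less_imp_le)
      finally show ?thesis .
    qed
    have "(\<lambda>p. (cmod (?b p))\<^sup>2 * Dweight \<alpha> p) summable_on UNIV"
    proof (rule nonneg_bdd_above_summable_on)
      show "bdd_above (sum (\<lambda>p. (cmod (?b p))\<^sup>2 * Dweight \<alpha> p) ` {F. F \<subseteq> UNIV \<and> finite F})"
      proof (rule bdd_aboveI2)
        fix F :: "(nat \<times> nat) set" assume "F \<in> {F. F \<subseteq> UNIV \<and> finite F}"
        then have F: "finite F" by simp
        define n where "n = Max (insert 0 (fst ` F))"
        define m where "m = Max (insert 0 (snd ` F))"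
        have "F \<subseteq> {..n} \<times> {..m}"
          using F by (auto simp: n_def m_def image_iff intro!: Max_ge) force+
        then have "(\<Sum>p\<in>F. (cmod (?b p))\<^sup>2 * Dweight \<alpha> p) \<le> (\<Sum>p\<in>{..n} \<times> {..m}. (cmod (?b p))\<^sup>2 * Dweight \<alpha> p)"
          using Dweight_pos by (intro sum_mono2) (auto simp: less_imp_le)
        also have "\<dots> \<le> C\<^sup>2 * A" using rect[of n m] by (simp add: case_prod_unfold)
        finally show "(\<Sum>p\<in>F. (cmod (?b p))\<^sup>2 * Dweight \<alpha> p) \<le> C\<^sup>2 * A" .
      qed
    qed (use Dweight_pos in \<open>auto simp: less_imp_le\<close>)
    with power_series2_mult[OF c a(1)] show "(\<lambda>p. \<phi> p * f p) \<in> Dspace \<alpha>"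
      unfolding Dspace_iff by blast
  qed
qed

theorem proposition3p9:
  fixes \<alpha> :: "real \<times> real"
  assumes "\<alpha> \<le> (0, 0)"
  shows "multipliers \<alpha> = Hinf_bidisc"
  using multipliers_subset_Hinf Hinf_subset_multipliers[OF assms] by blast

end
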